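(* Suppose $V$ is a complex vector space and $\rho$ a representation of $\widetilde L_+^\uparrow$ on $V$ by complex-linear maps; let $\rho^{hol}$ be its unique holomorphic extension to $(\widetilde L_+^\uparrow)^{\mathbb C}\cong L_+(\mathbb C)^\wedge$ acting on $V$, and $\rho''$ its restriction to $\widetilde L_+^\uparrow\cup{}^\flat\widetilde L_+^\downarrow$. Let $\sigma$ be the classical action of $\widetilde L_+^\uparrow$ induced by $\rho$ and $\omega$, and $\sigma''$ the classical action of $\widetilde L_+^\uparrow\cup{}^\flat\widetilde L_+^\downarrow$ induced by $\rho''$ and $\omega$. If a holomorphic formal field theory $\mathcal D$ is invariant under $\sigma(\widetilde L_+^\uparrow)$, then it is invariant under $\sigma''({}^\flat\widetilde L_+^\downarrow)$.
   Context: $M$ is a real vector space of dimension $d\ge3$ with Lorentzian $\eta$; $L_+^\uparrow$, $L_+^\downarrow$, $L_+$ are the identity component, the determinant-one time-reversing component, and their union. $L_+(\mathbb C)$ is the group of complex determinant-one isometries of $(M^{\mathbb C},\eta^{\mathbb C})$, $\pi\colon L_+(\mathbb C)^\wedge\to L_+(\mathbb C)$ its universal (double) cover; $\widetilde L_+^\uparrow=\pi^{-1}(L_+^\uparrow)$, ${}^\flat\widetilde L_+^\downarrow=\pi^{-1}(L_+^\downarrow)$; the inclusion identifies $L_+(\mathbb C)^\wedge$ with the complexification of $\widetilde L_+^\uparrow$. $\omega$ denotes the action on $M$ through $\pi$ (the standard action of $L_+$). $W=\mathrm{Hom}_{\mathbb R}(V,\mathbb C)$, $TM$ the real tensor algebra,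 $\mathcal K=\mathcal F(W\otimes_{\mathbb R}TM)$ the free non-commutative complex algebra on field symbols $\underline\Phi^\lambda_{\xi_1\cdots\xi_n}=\lambda\otimes(\xi_1\otimes\cdots\otimes\xi_n)$. A formal field theory is a complex affine subspace of $\mathcal K$. The classical action of a group $G$ induced by representations $\rho$ on $V$, $\omega$ on $M$ is the representation on $\mathcal K$ by complex-linear algebra automorphisms with $\sigma(g)\underline\Phi^\lambda_{\xi_1\cdots\xi_n}=\underline\Phi^{\lambda\circ\rho(g^{-1})}_{\omega(g)\xi_1\cdots\omega(g)\xi_n}$. Let $W^+\subset W$ be the complex-linear maps $V\to\mathbb C$ and $\mathcal K_{\mathbb C}=\mathcal F(W^+\otimes_{\mathbb R}TM)\subset\mathcal K$; a formal field theory is holomorphic if it is contained in $\mathcal K_{\mathbb C}$. Invariance means mapping $\mathcal D$ into $\mathcal D$.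
   Formalization: V is assumed finite-dimensional: otherwise the holomorphic extension need not exist and the claim can fail, e.g. V the algebraic functions on the complex group, λ evaluation at the identity, and D the span of the orbit of Φ^λ. *)

theory Defs
  imports "HOL-Analysis.Analysis" "HOL-Library.Function_Algebras"
begin

definition eta_form :: "real^'d^'d \<Rightarrow> real^'d \<Rightarrow> real^'d \<Rightarrow> real" where
  "eta_form \<eta> u v = u \<bullet> (\<eta> *v v)"

text \<open>Lorentzian: symmetric of signature (+,-,...,-) (mostly-minus convention; the
 Lorentz groups of eta and -eta coincide).\<close>
definition lorentzian :: "real^'d^'d \<Rightarrow> bool" where
  "lorentzian \<eta> \<longleftrightarrow> transpose \<eta> = \<eta> \<and>
     (\<exists>(P::real^'d^'d) t. invertible P \<and>
        transpose P ** \<eta> ** P = (\<chi> i j. if i = j then (if i = t then 1 else -1) else 0))"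

definition cmat :: "real^'d^'d \<Rightarrow> complex^'d^'d" where
  "cmat A = (\<chi> i j. complex_of_real (A$i$j))"

definition realmat :: "complex^'d^'d \<Rightarrow> real^'d^'d" where
  "realmat A = (\<chi> i j. Re (A$i$j))"

definition is_real_mat :: "complex^'d^'d \<Rightarrow> bool" where
  "is_real_mat A \<longleftrightarrow> (\<forall>i j. Im (A$i$j) = 0)"

definition LC :: "real^'d^'d \<Rightarrow> (complex^'d^'d) set" where
  "LC \<eta> = {A. transpose A ** cmat \<eta> ** A = cmat \<eta> \<and> det A = 1}"

definition orthochronous :: "real^'d^'d \<Rightarrow> real^'d^'d \<Rightarrow> bool" where
  "orthochronous \<eta> A \<longleftrightarrow>
     (\<forall>v. eta_form \<eta> v v > 0 \<longrightarrow> eta_form \<eta> v (A *v v) > 0)"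

definition Lup :: "real^'d^'d \<Rightarrow> (complex^'d^'d) set" where
  "Lup \<eta> = {A \<in> LC \<eta>. is_real_mat A \<and> orthochronous \<eta> (realmat A)}"

definition Ldown :: "real^'d^'d \<Rightarrow> (complex^'d^'d) set" where
  "Ldown \<eta> = {A \<in> LC \<eta>. is_real_mat A \<and> \<not> orthochronous \<eta> (realmat A)}"

definition topgroup :: "'g::topological_space set \<Rightarrow> ('g \<Rightarrow> 'g \<Rightarrow> 'g) \<Rightarrow> ('g \<Rightarrow> 'g) \<Rightarrow> 'g \<Rightarrow> bool" where
  "topgroup G mul ginv e \<longleftrightarrow>
     e \<in> G \<and> (\<forall>x\<in>G. \<forall>y\<in>G. mul x y \<in> G) \<and> (\<forall>x\<in>G. ginv x \<in> G) \<and>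
     (\<forall>x\<in>G. \<forall>y\<in>G. \<forall>z\<in>G. mul (mul x y) z = mul x (mul y z)) \<and>
     (\<forall>x\<in>G. mul e x = x \<and> mul x e = x \<and> mul (ginv x) x = e \<and> mul x (ginv x) = e) \<and>
     continuous_on (G \<times> G) (\<lambda>p. mul (fst p) (snd p)) \<and> continuous_on G ginv"

definition universal_cover ::
  "real^'d^'d \<Rightarrow> 'g::topological_space set \<Rightarrow> ('g \<Rightarrow> 'g \<Rightarrow> 'g) \<Rightarrow> ('g \<Rightarrow> 'g) \<Rightarrow> 'g
     \<Rightarrow> ('g \<Rightarrow> complex^'d^'d) \<Rightarrow> bool" where
  "universal_cover \<eta> G mul ginv e \<pi> \<longleftrightarrow>
     topgroup G mul ginv e \<and> simply_connected G \<and>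
     covering_space G \<pi> (LC \<eta>) \<and>
     (\<forall>x\<in>G. \<forall>y\<in>G. \<pi> (mul x y) = \<pi> x ** \<pi> y)"

definition cscale_mat :: "complex \<Rightarrow> complex^'m^'n \<Rightarrow> complex^'m^'n" where
  "cscale_mat c A = (\<chi> i j. c * A$i$j)"

definition holo_on :: "(complex^'a^'b) set \<Rightarrow> (complex^'a^'b \<Rightarrow> complex^'c^'e) \<Rightarrow> bool" where
  "holo_on Om F \<longleftrightarrow> (\<forall>x\<in>Om. \<exists>F'. (F has_derivative F') (at x) \<and>
      (\<forall>v. F' (cscale_mat \<i> v) = cscale_mat \<i> (F' v)))"

text \<open>Holomorphic function on G: the complex structure of G is pulled back along the local
 homeomorphism pi from the complex submanifold L_+(C) of the complex matrices; a function on
 L_+(C) is holomorphic iff locally it is the restriction of an ambient holomorphic function.\<close>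
definition holo_on_cover ::
  "real^'d^'d \<Rightarrow> 'g::topological_space set \<Rightarrow> ('g \<Rightarrow> complex^'d^'d) \<Rightarrow> ('g \<Rightarrow> complex^'c^'e) \<Rightarrow> bool" where
  "holo_on_cover \<eta> G \<pi> f \<longleftrightarrow>
     (\<forall>g\<in>G. \<exists>U Om F. openin (top_of_set G) U \<and> g \<in> U \<and> inj_on \<pi> U \<and>
        open Om \<and> \<pi> ` U = Om \<inter> LC \<eta> \<and> holo_on Om F \<and> (\<forall>h\<in>U. f h = F (\<pi> h)))"

definition holo_rep ::
  "real^'d^'d \<Rightarrow> 'g::topological_space set \<Rightarrow> ('g \<Rightarrow> 'g \<Rightarrow> 'g) \<Rightarrow> 'g
     \<Rightarrow> ('g \<Rightarrow> complex^'d^'d) \<Rightarrow> ('g \<Rightarrow> complex^'k^'k) \<Rightarrow> bool" where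
  "holo_rep \<eta> G mul e \<pi> \<rho> \<longleftrightarrow>
     \<rho> e = mat 1 \<and> (\<forall>x\<in>G. \<forall>y\<in>G. \<rho> (mul x y) = \<rho> x ** \<rho> y) \<and>
     holo_on_cover \<eta> G \<pi> \<rho>"

definition lift_up where "lift_up \<eta> G \<pi> = {g \<in> G. \<pi> g \<in> Lup \<eta>}"
definition lift_down where "lift_down \<eta> G \<pi> = {g \<in> G. \<pi> g \<in> Ldown \<eta>}"

definition omega :: "('g \<Rightarrow> complex^'d^'d) \<Rightarrow> 'g \<Rightarrow> real^'d \<Rightarrow> real^'d" where
  "omega \<pi> g \<xi> = realmat (\<pi> g) *v \<xi>"

text \<open>W = Hom_R(V,C) with V = complex^'k has the complex basis lambda_c, c :: bool \<times> 'k,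
 lambda_(False,j) v = Re (v$j), lambda_(True,j) v = Im (v$j);  the coordinates of lambda are
 lambda(e_j) and lambda(i e_j).  TM has the real basis of tensors e_{i1} (x) ... (x) e_{in},
 indexed by lists of indices.  Hence W (x)_R TM has complex basis indexed by letters
 (c, I), and the free algebra K has complex basis indexed by words (lists of letters);
 elements of K are finitely supported coefficient functions on words.\<close>

type_synonym ('k,'d) letter = "(bool \<times> 'k) \<times> 'd list"
type_synonym ('k,'d) kalg = "('k,'d) letter list \<Rightarrow> complex"

definition kelem :: "('k,'d) kalg \<Rightarrow> bool" where
  "kelem f \<longleftrightarrow> finite {w. f w \<noteq> 0}"

definition kword :: "('k,'d) letter list \<Rightarrow> ('k,'d) kalg" where
  "kword w = (\<lambda>u. if u = w then 1 else 0)"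

definition kscale :: "complex \<Rightarrow> ('k,'d) kalg \<Rightarrow> ('k,'d) kalg" where
  "kscale c f = (\<lambda>w. c * f w)"

definition kmul :: "('k,'d) kalg \<Rightarrow> ('k,'d) kalg \<Rightarrow> ('k,'d) kalg" where
  "kmul f g = (\<lambda>w. \<Sum>n\<le>length w. f (take n w) * g (drop n w))"

definition kone :: "('k,'d) kalg" where "kone = kword []"

definition wcoord :: "(complex^'k \<Rightarrow> complex) \<Rightarrow> bool \<times> 'k \<Rightarrow> complex" where
  "wcoord lam c = (if fst c then lam (axis (snd c) \<i>) else lam (axis (snd c) 1))"

definition wbasis :: "bool \<times> 'k \<Rightarrow> complex^'k \<Rightarrow> complex" where
  "wbasis c = (\<lambda>v. if fst c then complex_of_real (Im (v $ snd c)) else complex_of_real (Re (v $ snd c)))"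

text \<open>The field symbol Phi^lambda_{xi_1 ... xi_n} = lambda (x) (xi_1 (x) ... (x) xi_n), expanded
 in the basis.\<close>
definition Phi :: "(complex^'k \<Rightarrow> complex) \<Rightarrow> (real^'d) list \<Rightarrow> ('k::finite,'d::finite) kalg" where
  "Phi lam \<xi>s = (\<Sum>c\<in>UNIV. \<Sum>I\<in>{I. length I = length \<xi>s}.
      kscale (wcoord lam c * (\<Prod>j<length \<xi>s. complex_of_real ((\<xi>s!j) $ (I!j)))) (kword [(c, I)]))"

definition clinear_fun :: "(complex^'k \<Rightarrow> complex) \<Rightarrow> bool" where
  "clinear_fun lam \<longleftrightarrow> (\<forall>v w. lam (v + w) = lam v + lam w) \<and> (\<forall>c v. lam (c *s v) = c * lam v)"

text \<open>K_C = F(W^+ (x)_R TM), viewed as the subalgebra of K generated by the Phi^lambda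
 with lambda complex-linear.\<close>
inductive_set KC :: "('k::finite,'d::finite) kalg set" where
  gen: "clinear_fun lam \<Longrightarrow> Phi lam \<xi>s \<in> KC"
| one: "kone \<in> KC"
| zero: "0 \<in> KC"
| add: "f \<in> KC \<Longrightarrow> g \<in> KC \<Longrightarrow> f + g \<in> KC"
| scale: "f \<in> KC \<Longrightarrow> kscale c f \<in> KC"
| mul: "f \<in> KC \<Longrightarrow> g \<in> KC \<Longrightarrow> kmul f g \<in> KC"

definition formal_field_theory :: "('k,'d) kalg set \<Rightarrow> bool" where
  "formal_field_theory D \<longleftrightarrow> (\<forall>f\<in>D. kelem f) \<and>
     (\<forall>f\<in>D. \<forall>g\<in>D. \<forall>c::complex. kscale (1 - c) f + kscale c g \<in> D)"

definition holomorphic_fft :: "('k::finite,'d::finite) kalg set \<Rightarrow> bool" where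
  "holomorphic_fft D \<longleftrightarrow> formal_field_theory D \<and> D \<subseteq> KC"

text \<open>Classical action induced by rho and omega: the complex-linear algebra automorphism with
 sigma(g) Phi^lambda_{xi_1..xi_n} = Phi^{lambda o rho(g^-1)}_{omega(g) xi_1 .. omega(g) xi_n};
 on basis letters (c,I) (= Phi^{lambda_c}_{e_I}) it is given by this formula, and it is
 extended multiplicatively to words and linearly to K.\<close>
definition cl_letter ::
  "('g \<Rightarrow> 'g) \<Rightarrow> ('g \<Rightarrow> complex^'d^'d) \<Rightarrow> ('g \<Rightarrow> complex^'k^'k) \<Rightarrow> 'g
     \<Rightarrow> ('k::finite,'d::finite) letter \<Rightarrow> ('k,'d) kalg" where
  "cl_letter ginv \<pi> \<rho> g l =
     Phi (\<lambda>v. wbasis (fst l) (\<rho> (ginv g) *v v)) (map (\<lambda>i. omega \<pi> g (axis i 1)) (snd l))"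

definition cl_word ::
  "('g \<Rightarrow> 'g) \<Rightarrow> ('g \<Rightarrow> complex^'d^'d) \<Rightarrow> ('g \<Rightarrow> complex^'k^'k) \<Rightarrow> 'g
     \<Rightarrow> ('k::finite,'d::finite) letter list \<Rightarrow> ('k,'d) kalg" where
  "cl_word ginv \<pi> \<rho> g w = foldr kmul (map (cl_letter ginv \<pi> \<rho> g) w) kone"

definition cl_action ::
  "('g \<Rightarrow> 'g) \<Rightarrow> ('g \<Rightarrow> complex^'d^'d) \<Rightarrow> ('g \<Rightarrow> complex^'k^'k) \<Rightarrow> 'g
     \<Rightarrow> ('k::finite,'d::finite) kalg \<Rightarrow> ('k,'d) kalg" where
  "cl_action ginv \<pi> \<rho> g f = (\<Sum>w\<in>{w. f w \<noteq> 0}. kscale (f w) (cl_word ginv \<pi> \<rho> g w))"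

definition invariant_under :: "('k,'d) kalg set \<Rightarrow> (('k,'d) kalg \<Rightarrow> ('k,'d) kalg) set \<Rightarrow> bool" where
  "invariant_under D S \<longleftrightarrow> (\<forall>s\<in>S. \<forall>f\<in>D. s f \<in> D)"

end

(* Replace the real matrix of the action on M by a complex one: this gives complex-linear
   automorphisms act R M of the free algebra, multiplicative in (R, M), which agree with
   sigma and sigma'' over real group elements and whose coefficients on a fixed element of
   K_C are polynomial, hence holomorphic, in the entries of R and M.

   Let cboost z be the boost of complex rapidity z in some time-space plane.  It is real
   orthochronous for real z and equals the half turn diag(-1, -1, 1, ..., 1) at z = i pi.
   For small z it lifts to the cover through a sheet at the identity, and the action of the
   lift on an element of D is holomorphic in z and stays in the affine space D for real z.
   A linear functional separating a point from D and the identity theorem in one variable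
   show that it stays in D for all small z.  The N-th power of the lift at i pi / N is an
   element over the half turn that preserves D, and multiplying a time-reversing element by
   it gives an orthochronous one. *)
theory Submission
  imports Defs "HOL-Complex_Analysis.Conformal_Mappings"
begin

section \<open>Convolution of coefficient functions and the universal property of the free
  algebra\<close>

section \<open>The free algebra\<close>

text \<open>Functions instantiated by higher-order unification are eta-expanded, and these two rules
  would then tear a sum of elements of the algebra apart.\<close>
declare plus_fun_apply [simp del] zero_fun_apply [simp del]

text \<open>The algebra endomorphism determined by its values \<open>\<phi>\<close> on the letters.
  On a function of infinite support the sum takes the default value 0, which is why linearity and
  multiplicativity are stated for \<open>kelem\<close> arguments.\<close>

definition kext :: "(('k,'d) letter \<Rightarrow> ('k,'d) kalg) \<Rightarrow> ('k,'d) kalg \<Rightarrow> ('k,'d) kalg" where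
  "kext \<phi> f = (\<Sum>w\<in>{w. f w \<noteq> 0}. kscale (f w) (foldr kmul (map \<phi> w) kone))"

lemma sum_kalg_apply: "(\<Sum>i\<in>A. F i) w = (\<Sum>i\<in>A. F i w)" for F :: "'i \<Rightarrow> ('k,'d) kalg"
  by (induction A rule: infinite_finite_induct) (auto simp: plus_fun_apply zero_fun_apply)

lemma kscale_simps [simp]:
  "kscale c 0 = 0" "kscale 0 f = 0" "kscale 1 f = f"
  "kscale c (f + g) = kscale c f + kscale c g"
  "kscale (c + d) f = kscale c f + kscale d f"
  "kscale c (kscale d f) = kscale (c * d) f"
  by (auto simp: kscale_def fun_eq_iff plus_fun_apply zero_fun_apply algebra_simps)

lemma kscale_sum: "kscale c (\<Sum>i\<in>A. F i) = (\<Sum>i\<in>A. kscale c (F i))"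
  by (induction A rule: infinite_finite_induct) auto

lemma kmul_simps [simp]:
  "kmul 0 f = 0" "kmul f 0 = 0"
  "kmul (f + g) h = kmul f h + kmul g h" "kmul h (f + g) = kmul h f + kmul h g"
  "kmul (kscale c f) g = kscale c (kmul f g)" "kmul f (kscale c g) = kscale c (kmul f g)"
  by (auto simp: kmul_def kscale_def fun_eq_iff plus_fun_apply zero_fun_apply algebra_simps sum.distrib sum_distrib_left)

text \<open>Among the cuts of a word \<open>w\<close> only the one after \<open>length u\<close>
  letters can contribute to the convolution, and it does so exactly if
  \<open>w = u @ v\<close>.\<close>

lemma kmul_kword: "kmul (kword u) (kword v) = kword (u @ v)"
proof
  fix w :: "('a, 'b) letter list"
  have "kmul (kword u) (kword v) w
      = (\<Sum>n\<le>length w. if n = length u then (if w = u @ v then 1 else 0) else 0)"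
    unfolding kmul_def
  proof (rule sum.cong [OF refl])
    fix n assume "n \<in> {..length w}"
    then have "length (take n w) = n" by simp
    then have iff: "take n w = u \<and> drop n w = v \<longleftrightarrow> n = length u \<and> w = u @ v"
      by (auto simp: append_eq_conv_conj)
    have "kword u (take n w) * kword v (drop n w)
        = (if take n w = u \<and> drop n w = v then 1 else 0)"
      by (simp add: kword_def)
    then show "kword u (take n w) * kword v (drop n w)
        = (if n = length u then (if w = u @ v then 1 else 0) else 0)"
      unfolding iff by simp
  qed
  also have "\<dots> = kword (u @ v) w"
    by (auto simp: kword_def)
  finally show "kmul (kword u) (kword v) w = kword (u @ v) w" .
qed

lemma kmul_kone [simp]: "kmul kone f = f" "kmul f kone = f"
proof -
  show "kmul kone f = f"
  proof
    fix w
    have "kmul kone f w = (\<Sum>n\<le>length w. if n = 0 then f w else 0)"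
      unfolding kmul_def by (rule sum.cong) (auto simp: kone_def kword_def)
    then show "kmul kone f w = f w" by simp
  qed
  show "kmul f kone = f"
  proof
    fix w
    have "kmul f kone w = (\<Sum>n\<le>length w. if n = length w then f w else 0)"
      unfolding kmul_def by (rule sum.cong) (auto simp: kone_def kword_def)
    then show "kmul f kone w = f w" by simp
  qed
qed

text \<open>Both sides sum over all cuts of \<open>w\<close> into three pieces; \<open>m\<close> and
  \<open>k\<close> are the lengths of the first two.\<close>

lemma kmul_assoc: "kmul (kmul f g) h = kmul f (kmul g h)"
proof
  fix w
  define a where "a m k = f (take m w) * g (take k (drop m w)) * h (drop (m + k) w)" for m k
  have "kmul (kmul f g) h w = (\<Sum>n\<le>length w. \<Sum>m\<le>n. a m (n - m))"
    unfolding kmul_def sum_distrib_right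
    by (intro sum.cong) (auto simp: a_def min_def drop_take)
  also have "\<dots> = (\<Sum>(m, k)\<in>{(m, k). m + k \<le> length w}. a m k)"
    by (simp add: sum.triangle_reindex_eq)
  also have "{(m, k). m + k \<le> length w} = (SIGMA m:{..length w}. {..length w - m})"
    by auto
  also have "(\<Sum>(m, k)\<in>\<dots>. a m k) = (\<Sum>m\<le>length w. \<Sum>k\<le>length w - m. a m k)"
    by (simp add: sum.Sigma)
  also have "\<dots> = kmul f (kmul g h) w"
    unfolding kmul_def sum_distrib_left
    by (intro sum.cong) (auto simp: a_def add.commute mult.assoc)
  finally show "kmul (kmul f g) h w = kmul f (kmul g h) w" .
qed

lemma kelem_simps [simp]: "kelem 0" "kelem (kword w)" "kelem kone"
  by (auto simp: kelem_def kword_def kone_def zero_fun_apply)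

lemma kelem_add [intro]: "kelem f \<Longrightarrow> kelem g \<Longrightarrow> kelem (f + g)"
  unfolding kelem_def
  by (rule finite_subset [of _ "{w. f w \<noteq> 0} \<union> {w. g w \<noteq> 0}"]) (auto simp: plus_fun_apply)

lemma kelem_kscale [intro]: "kelem f \<Longrightarrow> kelem (kscale c f)"
  unfolding kelem_def
  by (rule finite_subset [of _ "{w. f w \<noteq> 0}"]) (auto simp: kscale_def)

lemma kelem_sum: "(\<And>i. i \<in> A \<Longrightarrow> kelem (F i)) \<Longrightarrow> kelem (\<Sum>i\<in>A. F i)"
  by (induction A rule: infinite_finite_induct) auto

text \<open>\<open>T\<close> may exceed the support, so one set can serve a whole family of
  elements; the curves in the continuation argument rely on this.\<close>

lemma kelem_expand:
  assumes "finite T" "\<And>w. w \<notin> T \<Longrightarrow> f w = 0"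
  shows "f = (\<Sum>w\<in>T. kscale (f w) (kword w))"
proof
  fix w
  have "(\<Sum>u\<in>T. kscale (f u) (kword u)) w = (\<Sum>u\<in>T. if u = w then f w else 0)"
    unfolding sum_kalg_apply by (rule sum.cong) (auto simp: kscale_def kword_def)
  then show "f w = (\<Sum>u\<in>T. kscale (f u) (kword u)) w"
    using assms by (auto simp: sum.delta)
qed

lemma kelem_induct [consumes 1, case_names zero word add scale]:
  assumes "kelem f" "P 0" "\<And>w. P (kword w)"
    and add: "\<And>f g. kelem f \<Longrightarrow> kelem g \<Longrightarrow> P f \<Longrightarrow> P g \<Longrightarrow> P (f + g)"
    and scale: "\<And>c f. kelem f \<Longrightarrow> P f \<Longrightarrow> P (kscale c f)"
  shows "P f"
proof -
  have "kelem (\<Sum>w\<in>T. kscale (c w) (kword w)) \<and> P (\<Sum>w\<in>T. kscale (c w) (kword w))"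
    if "finite T" for T c
    using that by (induction T rule: finite_induct) (auto intro!: assms kelem_add kelem_kscale)
  moreover have fin: "finite {w. f w \<noteq> 0}" using \<open>kelem f\<close> by (simp add: kelem_def)
  ultimately have "P (\<Sum>w\<in>{w. f w \<noteq> 0}. kscale (f w) (kword w))" by blast
  moreover have "(\<Sum>w\<in>{w. f w \<noteq> 0}. kscale (f w) (kword w)) = f"
    by (rule kelem_expand [OF fin, symmetric]) simp
  ultimately show ?thesis by (simp only:)
qed

lemma kelem_kmul [intro]:
  assumes "kelem f" "kelem g" shows "kelem (kmul f g)"
  using assms(1)
proof (induction rule: kelem_induct)
  case (word w)
  show ?case using assms(2)
    by (induction rule: kelem_induct) (auto simp: kmul_kword)
qed auto

text \<open>Supports can shrink under sums and scaling, so linearity of \<open>kext\<close> is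
  checked over a common finite set of words.\<close>

lemma kext_superset:
  assumes "finite T" "\<And>w. w \<notin> T \<Longrightarrow> f w = 0"
  shows "kext \<phi> f = (\<Sum>w\<in>T. kscale (f w) (foldr kmul (map \<phi> w) kone))"
  unfolding kext_def by (rule sum.mono_neutral_left) (use assms in auto)

lemma kext_zero [simp]: "kext \<phi> 0 = 0"
  by (simp add: kext_def zero_fun_apply)

lemma kext_add:
  assumes "kelem f" "kelem g" shows "kext \<phi> (f + g) = kext \<phi> f + kext \<phi> g"
proof -
  let ?T = "{w. f w \<noteq> 0} \<union> {w. g w \<noteq> 0}"
  have T: "finite ?T" using assms by (auto simp: kelem_def)
  show ?thesis
    by (subst (1 2 3) kext_superset [OF T]) (auto simp: sum.distrib plus_fun_apply)
qed

lemma kext_kscale: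
  assumes "kelem f" shows "kext \<phi> (kscale c f) = kscale c (kext \<phi> f)"
proof -
  have T: "finite {w. f w \<noteq> 0}" using assms by (auto simp: kelem_def)
  show ?thesis
    by (subst (1 2) kext_superset [OF T]) (auto simp: kscale_sum, simp_all add: kscale_def)
qed

lemma kext_kword: "kext \<phi> (kword w) = foldr kmul (map \<phi> w) kone"
  by (subst kext_superset [of "{w}"]) (auto simp: kword_def)

lemma kext_kone [simp]: "kext \<phi> kone = kone"
  by (simp add: kone_def kext_kword) 

lemma kext_sum:
  assumes "\<And>i. i \<in> A \<Longrightarrow> kelem (F i)"
  shows "kext \<phi> (\<Sum>i\<in>A. F i) = (\<Sum>i\<in>A. kext \<phi> (F i))"
  using assms
  by (induction A rule: infinite_finite_induct) (auto simp: kext_add kelem_sum)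

lemma foldr_kmul_append:
  "foldr kmul (us @ vs) kone = kmul (foldr kmul us kone) (foldr kmul vs kone)"
  by (induction us) (auto simp: kmul_assoc)

text \<open>Bilinearity reduces the claim to two words, where it says that a product over a
  concatenation splits.\<close>

lemma kext_kmul:
  assumes "kelem f" "kelem g"
  shows "kext \<phi> (kmul f g) = kmul (kext \<phi> f) (kext \<phi> g)"
  using assms(1)
proof (induction rule: kelem_induct)
  case (word w)
  show ?case using assms(2)
    by (induction rule: kelem_induct)
      (auto simp: kmul_kword kext_kword kext_add kext_kscale kelem_kmul foldr_kmul_append
        simp del: foldr_append)
qed (use assms(2) in \<open>auto simp: kext_add kext_kscale kelem_kmul\<close>)

lemma kelem_foldr:
  assumes "\<And>l. kelem (\<phi> l)" shows "kelem (foldr kmul (map \<phi> w) kone)"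
  using assms by (induction w) auto

lemma kelem_kext:
  assumes "\<And>l. kelem (\<phi> l)" shows "kelem (kext \<phi> f)"
  unfolding kext_def by (intro kelem_sum kelem_kscale kelem_foldr assms)

lemma kext_kext:
  assumes "kelem f" and \<phi>: "\<And>l. kelem (\<phi> l)" and \<psi>: "\<And>l. kelem (\<psi> l)"
  shows "kext \<phi> (kext \<psi> f) = kext (\<lambda>l. kext \<phi> (\<psi> l)) f"
  using assms(1)
proof (induction rule: kelem_induct)
  case (word w)
  show ?case unfolding kext_kword
    by (induction w) (auto simp: kext_kmul \<psi> kelem_foldr)
qed (auto simp: kext_add kext_kscale kelem_kext \<psi>)

section \<open>Field symbols on complexified vectors and their expansion in the letter basis\<close>

section \<open>Field symbols with complex arguments\<close>

text \<open>Since K is a complex algebra, the tensor slots can be extended from M to its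
  complexification. A boost of complex rapidity moves real vectors out of M, so its action needs
  these symbols.\<close>

definition PhiC :: "(complex^'k \<Rightarrow> complex) \<Rightarrow> (complex^'d) list \<Rightarrow> ('k::finite,'d::finite) kalg" where
  "PhiC lam \<xi>s = (\<Sum>c\<in>UNIV. \<Sum>I\<in>{I. length I = length \<xi>s}.
      kscale (wcoord lam c * (\<Prod>j<length \<xi>s. (\<xi>s!j) $ (I!j))) (kword [(c, I)]))"

definition cvec :: "real^'d \<Rightarrow> complex^'d" where
  "cvec \<xi> = (\<chi> i. complex_of_real (\<xi> $ i))"

lemma Phi_eq_PhiC: "Phi lam \<xi>s = PhiC lam (map cvec \<xi>s)"
  unfolding Phi_def PhiC_def by (simp add: cvec_def)

lemma finite_length_eq: "finite {I :: 'd::finite list. length I = n}"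
  using finite_lists_length_eq [of "UNIV :: 'd set" n] by simp

lemma kelem_PhiC [simp]: "kelem (PhiC lam \<xi>s)"
  unfolding PhiC_def by (intro kelem_sum kelem_kscale) simp

lemma PhiC_apply:
  fixes \<xi>s :: "(complex^'d::finite) list" and lam :: "complex^'k::finite \<Rightarrow> complex"
  shows "PhiC lam \<xi>s u = (if \<exists>c I. u = [(c, I)] \<and> length I = length \<xi>s
     then wcoord lam (fst (hd u)) * (\<Prod>j<length \<xi>s. (\<xi>s!j) $ (snd (hd u) ! j)) else 0)"
proof -
  let ?S = "(UNIV :: (bool \<times> 'k) set) \<times> {I :: 'd list. length I = length \<xi>s}"
  define a where "a p = wcoord lam (fst p) * (\<Prod>j<length \<xi>s. (\<xi>s!j) $ (snd p ! j))" for p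
  have fin: "finite ?S" by (simp add: finite_length_eq)
  have "PhiC lam \<xi>s u = (\<Sum>p\<in>?S. a p * kword [p] u)"
    unfolding PhiC_def sum_kalg_apply
    by (simp add: kscale_def sum.cartesian_product case_prod_unfold a_def)
  also have "\<dots> = (\<Sum>p\<in>?S. if [p] = u then a p else 0)"
    by (rule sum.cong) (auto simp: kword_def)
  also have "\<dots> = (if \<exists>c I. u = [(c, I)] \<and> length I = length \<xi>s then a (hd u) else 0)"
  proof (cases "\<exists>q. u = [q]")
    case True
    then obtain q where q: "u = [q]" ..
    show ?thesis
      using fin by (cases q) (simp add: q sum.delta)
  next
    case False
    then have "(if [p] = u then a p else 0) = 0" for p by (cases p, cases "fst p") auto
    then show ?thesis using False by (simp add: sum.neutral)
  qed
  finally show ?thesis unfolding a_def .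
qed

text \<open>Distributivity for a product of \<open>n\<close> sums, by splitting off the head of the
  index list. It lets the tensor slots be contracted one by one.\<close>

lemma sum_lists_prod:
  fixes a :: "nat \<Rightarrow> 'd::finite \<Rightarrow> 'a::comm_semiring_1"
  shows "(\<Sum>I\<in>{I. length I = n}. \<Prod>j<n. a j (I!j)) = (\<Prod>j<n. \<Sum>i\<in>UNIV. a j i)"
proof (induction n arbitrary: a)
  case (Suc n)
  have eq: "{I :: 'd list. length I = Suc n} = (\<lambda>(i, I). i # I) ` (UNIV \<times> {I. length I = n})"
    by (auto simp: length_Suc_conv image_iff)
  have "(\<Sum>I\<in>{I. length I = Suc n}. \<Prod>j<Suc n. a j (I!j))
      = (\<Sum>(i, I)\<in>UNIV \<times> {I. length I = n}. a 0 i * (\<Prod>j<n. a (Suc j) (I!j)))"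
    unfolding eq
    by (subst sum.reindex) (auto simp: inj_on_def case_prod_unfold prod.lessThan_Suc_shift simp del: prod.lessThan_Suc)
  also have "\<dots> = (\<Sum>i\<in>UNIV. a 0 i) * (\<Sum>I\<in>{I. length I = n}. \<Prod>j<n. a (Suc j) (I!j))"
    by (simp add: sum_product sum.cartesian_product)
  finally show ?case
    by (simp only: Suc.IH [of "\<lambda>j. a (Suc j)"] prod.lessThan_Suc_shift)
qed auto

text \<open>Each coordinate of \<open>v\<close> splits into a real multiple of 1 and a real multiple
  of \<open>\<i>\<close>; the \<open>wbasis\<close> functions are the dual real coordinates. Only
  real linearity of \<open>lam\<close> enters.\<close>

lemma linear_wcoord_expand:
  fixes lam :: "complex^'k::finite \<Rightarrow> complex"
  assumes "linear lam"
  shows "lam v = (\<Sum>c\<in>UNIV. wcoord lam c * wbasis c v)"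
proof -
  have v: "(\<Sum>j\<in>UNIV. Re (v $ j) *\<^sub>R axis j 1 + Im (v $ j) *\<^sub>R axis j \<i>) = v"
  proof (rule vec_eq_iff [THEN iffD2], rule allI)
    fix i
    have "(\<Sum>j\<in>UNIV. Re (v $ j) *\<^sub>R axis j 1 + Im (v $ j) *\<^sub>R axis j \<i>) $ i
        = (\<Sum>j\<in>UNIV. if j = i then v $ i else 0)"
      unfolding sum_component by (rule sum.cong) (auto simp: axis_def complex_eq_iff)
    then show "(\<Sum>j\<in>UNIV. Re (v $ j) *\<^sub>R axis j 1 + Im (v $ j) *\<^sub>R axis j \<i>) $ i = v $ i"
      by simp
  qed
  have "lam (\<Sum>j\<in>UNIV. Re (v $ j) *\<^sub>R axis j 1 + Im (v $ j) *\<^sub>R axis j \<i>)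
      = (\<Sum>j\<in>UNIV. of_real (Re (v $ j)) * lam (axis j 1) + of_real (Im (v $ j)) * lam (axis j \<i>))"
    by (simp add: linear_sum [OF assms] linear_add [OF assms] linear_scale [OF assms]
        scaleR_conv_of_real [where 'a = complex])
  then have "lam v = (\<Sum>j\<in>UNIV. of_real (Re (v $ j)) * lam (axis j 1) + of_real (Im (v $ j)) * lam (axis j \<i>))"
    unfolding v .
  also have "\<dots> = (\<Sum>b\<in>UNIV. \<Sum>j\<in>UNIV. wcoord lam (b, j) * wbasis (b, j) v)"
    by (simp add: UNIV_bool wcoord_def wbasis_def sum.distrib mult.commute add.commute)
  also have "\<dots> = (\<Sum>c\<in>UNIV. wcoord lam c * wbasis c v)"
    by (simp add: sum.cartesian_product case_prod_unfold)
  finally show ?thesis .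
qed

section \<open>Action of pairs of complex matrices on K: composition law and holomorphic
  dependence\<close>

section \<open>The complexified action\<close>

lemma matrix_vector_mult_axis: "(A *v axis i c) $ m = A $ m $ i * c"
  by (simp add: matrix_vector_mult_def axis_def if_distrib cong: if_cong)

text \<open>\<open>R\<close> stands for \<rho>(g^-1) and \<open>M\<close> for \<omega>(g). Both are
  arbitrary complex matrices, so the action also makes sense where the group element does not act on
  the real space.\<close>

definition act_letter ::
  "complex^'k^'k \<Rightarrow> complex^'d^'d \<Rightarrow> ('k::finite,'d::finite) letter \<Rightarrow> ('k,'d) kalg" where
  "act_letter R M l = PhiC (\<lambda>v. wbasis (fst l) (R *v v)) (map (\<lambda>i. M *v axis i 1) (snd l))"

definition act ::
  "complex^'k^'k \<Rightarrow> complex^'d^'d \<Rightarrow> ('k::finite,'d::finite) kalg \<Rightarrow> ('k,'d) kalg" where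
  "act R M = kext (act_letter R M)"

lemma kelem_act_letter [simp]: "kelem (act_letter R M l)"
  by (simp add: act_letter_def)

lemma linear_wbasis: "linear (\<lambda>v. wbasis c (R *v v))"
proof (rule linearI)
  fix v w r
  show "wbasis c (R *v (v + w)) = wbasis c (R *v v) + wbasis c (R *v w)"
    by (simp add: wbasis_def matrix_vector_right_distrib)
  have "R *v (r *\<^sub>R v) = r *\<^sub>R (R *v v)"
    by (simp add: matrix_vector_mult_def vec_eq_iff scaleR_sum_right)
  then show "wbasis c (R *v (r *\<^sub>R v)) = r *\<^sub>R wbasis c (R *v v)"
    by (simp add: wbasis_def scaleR_conv_of_real [where 'a = complex])
qed

text \<open>The action is prescribed on basis letters only; multilinearity of the symbol carries the
  formula to every real-linear \<open>lam\<close> and all complex vectors.\<close>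

lemma act_PhiC:
  assumes "linear lam"
  shows "act R M (PhiC lam \<xi>s) = PhiC (\<lambda>v. lam (R *v v)) (map (\<lambda>\<xi>. M *v \<xi>) \<xi>s)"
proof
  fix u
  let ?n = "length \<xi>s"
  have 1: "act R M (PhiC lam \<xi>s) u = (\<Sum>c\<in>UNIV. \<Sum>I\<in>{I. length I = ?n}.
      wcoord lam c * (\<Prod>j<?n. (\<xi>s!j) $ (I!j)) * act_letter R M (c, I) u)"
    unfolding act_def PhiC_def
    by (simp add: kext_sum kelem_sum kelem_kscale kext_kscale kext_kword sum_kalg_apply)
      (simp add: kscale_def)
  show "act R M (PhiC lam \<xi>s) u = PhiC (\<lambda>v. lam (R *v v)) (map (\<lambda>\<xi>. M *v \<xi>) \<xi>s) u"
  proof (cases "\<exists>c I. u = [(c, I)] \<and> length I = ?n")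
    case False
    then have "act_letter R M (c, I) u = 0" if "length I = ?n" for c I
      using that by (simp only: act_letter_def PhiC_apply length_map snd_conv if_False)
    then have "act R M (PhiC lam \<xi>s) u = 0"
      unfolding 1 by (simp add: sum.neutral)
    then show ?thesis
      using False by (simp only: PhiC_apply length_map if_False)
  next
    case True
    then obtain c' J where u: "u = [(c', J)]" and J: "length J = ?n" by auto
    have "act R M (PhiC lam \<xi>s) u = (\<Sum>c\<in>UNIV. \<Sum>I\<in>{I. length I = ?n}.
      (wcoord lam c * wcoord (\<lambda>v. wbasis c (R *v v)) c') * (\<Prod>j<?n. (\<xi>s!j) $ (I!j) * M $ (J!j) $ (I!j)))"
      unfolding 1
      by (intro sum.cong refl)
        (auto simp: u J act_letter_def PhiC_apply prod.distrib matrix_vector_mult_axis)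
    \<comment> \<open>The double sum factors into a contraction over V and one contraction for each
      tensor slot.\<close>
    also have "\<dots> = (\<Sum>c\<in>UNIV. wcoord lam c * wcoord (\<lambda>v. wbasis c (R *v v)) c') *
        (\<Prod>j<?n. \<Sum>i\<in>UNIV. (\<xi>s!j) $ i * M $ (J!j) $ i)"
      unfolding sum_lists_prod [symmetric] sum_product ..
    also have "(\<Sum>c\<in>UNIV. wcoord lam c * wcoord (\<lambda>v. wbasis c (R *v v)) c') =
        wcoord (\<lambda>v. lam (R *v v)) c'"
      by (simp add: wcoord_def linear_wcoord_expand [OF assms, of "R *v _"])
    also have "(\<Prod>j<?n. \<Sum>i\<in>UNIV. (\<xi>s!j) $ i * M $ (J!j) $ i) =
        (\<Prod>j<?n. (map (\<lambda>\<xi>. M *v \<xi>) \<xi>s ! j) $ (J ! j))"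
      by (intro prod.cong) (auto simp: matrix_vector_mult_def mult.commute)
    also have "wcoord (\<lambda>v. lam (R *v v)) c' * \<dots>
        = PhiC (\<lambda>v. lam (R *v v)) (map (\<lambda>\<xi>. M *v \<xi>) \<xi>s) u"
      by (simp add: PhiC_apply u J)
    finally show ?thesis .
  qed
qed

text \<open>Functionals are pulled back, so the matrices on V compose in the order opposite to those
  on M. This matches the inverse in \<rho>(g^-1).\<close>

lemma act_act:
  assumes "kelem f"
  shows "act R M (act R' M' f) = act (R' ** R) (M ** M') f"
proof -
  have "act R M (act_letter R' M' l) = act_letter (R' ** R) (M ** M') l" for l
    unfolding act_letter_def act_PhiC [OF linear_wbasis]
    by (simp add: matrix_vector_mul_assoc o_def)
  then show ?thesis
    unfolding act_def by (subst kext_kext [OF assms]) (simp_all add: act_def)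
qed

lemma clinear_fun_linear: "clinear_fun lam \<Longrightarrow> linear lam"
proof (rule linearI)
  fix r :: real and v :: "complex^'a"
  assume "clinear_fun lam"
  moreover have "r *\<^sub>R v = of_real r *s v"
    unfolding vec_eq_iff by (auto simp: scaleR_conv_of_real[where 'a=complex])
  ultimately show "lam (r *\<^sub>R v) = r *\<^sub>R lam v"
    by (simp add: clinear_fun_def scaleR_conv_of_real [where 'a = complex])
qed (simp add: clinear_fun_def)

lemma kelem_KC: "f \<in> KC \<Longrightarrow> kelem f"
  by (induction rule: KC.induct) (auto simp: Phi_eq_PhiC)

lemma clinear_fun_expand:
  assumes "clinear_fun lam"
  shows "lam v = (\<Sum>m\<in>UNIV. v $ m * lam (axis m 1))"
proof -
  have "v = (\<Sum>m\<in>UNIV. v $ m *s axis m 1)"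
    by (simp add: basis_expansion)
  then have "lam v = lam (\<Sum>m\<in>UNIV. v $ m *s axis m 1)"
    by simp
  also have "\<dots> = (\<Sum>m\<in>UNIV. lam (v $ m *s axis m 1))"
    by (rule linear_sum) (rule clinear_fun_linear [OF assms])
  finally show ?thesis
    using assms by (simp add: clinear_fun_def)
qed

text \<open>This is where membership in \<open>KC\<close> matters: for complex-linear
  \<open>lam\<close> the coordinates of \<open>lam\<close> after \<open>R\<close> are linear in the
  entries of \<open>R\<close>, while a merely real-linear \<open>lam\<close> would bring in complex
  conjugates. The set \<open>T\<close> bounds the supports uniformly in \<open>z\<close>.\<close>

lemma holomorphic_act:
  assumes "f \<in> KC"
    and R: "\<And>i j. (\<lambda>z. R z $ i $ j) holomorphic_on S"
    and M: "\<And>i j. (\<lambda>z. M z $ i $ j) holomorphic_on S"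
  shows "\<exists>T. finite T \<and> (\<forall>w. (\<lambda>z. act (R z) (M z) f w) holomorphic_on S) \<and>
           (\<forall>z w. w \<notin> T \<longrightarrow> act (R z) (M z) f w = 0)"
  using assms(1)
proof (induction rule: KC.induct)
  case (gen lam \<xi>s)
  note lin = clinear_fun_linear [OF gen]
  let ?\<xi> = "map cvec \<xi>s"
  let ?T = "(\<lambda>p. [p]) ` (UNIV \<times> {I. length I = length \<xi>s})"
  have wc: "(\<lambda>z. wcoord (\<lambda>v. lam (R z *v v)) c) holomorphic_on S" for c
    unfolding wcoord_def clinear_fun_expand [OF gen, of "_ *v _"]
    by (cases "fst c") (auto simp: matrix_vector_mult_axis intro!: holomorphic_intros R)
  have Mv: "(\<lambda>z. (M z *v v) $ i) holomorphic_on S" for v i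
    unfolding matrix_vector_mult_def by (auto intro!: holomorphic_intros M)
  have "(\<lambda>z. act (R z) (M z) (Phi lam \<xi>s) w) holomorphic_on S" for w
  proof (cases "\<exists>c I. w = [(c, I)] \<and> length I = length \<xi>s")
    case True
    then obtain c I where "w = [(c, I)]" "length I = length \<xi>s" by blast
    then show ?thesis
      unfolding Phi_eq_PhiC act_PhiC [OF lin] PhiC_apply
      by (auto intro!: holomorphic_intros wc Mv)
  next
    case False
    then show ?thesis
      unfolding Phi_eq_PhiC act_PhiC [OF lin] PhiC_apply length_map by (simp only: if_False holomorphic_on_const)
  qed
  moreover have "act (R z) (M z) (Phi lam \<xi>s) w = 0" if "w \<notin> ?T" for z w
    using that unfolding Phi_eq_PhiC act_PhiC [OF lin] PhiC_apply by auto
  ultimately show ?case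
    by (intro exI [of _ ?T]) (auto simp: finite_length_eq)
next
  case one
  then show ?case
    by (intro exI [of _ "{[]}"]) (auto simp: act_def kone_def [symmetric], simp add: kone_def kword_def)
next
  case zero
  have "act (R z) (M z) 0 w = 0" for z w by (simp add: act_def zero_fun_apply)
  then show ?case by (intro exI [of _ "{}"]) (simp only: holomorphic_on_const finite.emptyI simp_thms)
next
  case (add f g)
  then obtain T T' where "finite T" "finite T'"
    "\<And>z w. w \<notin> T \<Longrightarrow> act (R z) (M z) f w = 0" "\<And>z w. w \<notin> T' \<Longrightarrow> act (R z) (M z) g w = 0"
    by meson
  moreover have "act (R z) (M z) (f + g) w = act (R z) (M z) f w + act (R z) (M z) g w" for z w
    using add by (simp add: act_def kext_add kelem_KC plus_fun_apply)
  ultimately show ?case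
    using add by (intro exI [of _ "T \<union> T'"]) (auto intro!: holomorphic_intros)
next
  case (scale f c)
  then obtain T where "finite T" "\<And>z w. w \<notin> T \<Longrightarrow> act (R z) (M z) f w = 0"
    by meson
  with scale show ?case
    by (intro exI [of _ T])
      (auto simp: act_def kext_kscale kelem_KC, simp_all add: kscale_def holomorphic_intros)
next
  case (mul f g)
  then obtain T T' where T: "finite T" "finite T'"
    "\<And>z w. w \<notin> T \<Longrightarrow> act (R z) (M z) f w = 0" "\<And>z w. w \<notin> T' \<Longrightarrow> act (R z) (M z) g w = 0"
    by meson
  have eq: "act (R z) (M z) (kmul f g) = kmul (act (R z) (M z) f) (act (R z) (M z) g)" for z
    using mul by (simp add: act_def kext_kmul kelem_KC)
  \<comment> \<open>A word that is no concatenation from \<open>T\<close> and \<open>T'\<close> has,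
    at every cut, a piece outside one of the two supports.\<close>
  have "kmul (act (R z) (M z) f) (act (R z) (M z) g) w = 0"
    if "w \<notin> (\<lambda>(u, v). u @ v) ` (T \<times> T')" for z w
    unfolding kmul_def
  proof (rule sum.neutral, rule ballI)
    fix n
    have "take n w \<notin> T \<or> drop n w \<notin> T'"
      using that by (force simp: image_iff)
    then show "act (R z) (M z) f (take n w) * act (R z) (M z) g (drop n w) = 0"
      using T by auto
  qed
  moreover have "(\<lambda>z. kmul (act (R z) (M z) f) (act (R z) (M z) g) w) holomorphic_on S" for w
    unfolding kmul_def using mul by (auto intro!: holomorphic_intros)
  ultimately show ?case
    unfolding eq using T by (intro exI [of _ "(\<lambda>(u, v). u @ v) ` (T \<times> T')"]) auto
qed

lemma realmat_mult_axis:
  assumes "is_real_mat A"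
  shows "cvec (realmat A *v axis i 1) = A *v axis i 1"
  using assms
  by (auto simp: vec_eq_iff cvec_def realmat_def matrix_vector_mult_axis is_real_mat_def
      complex_eq_iff)

text \<open>\<open>omega\<close> keeps only the real parts of the entries of \<open>\<pi> g\<close>,
  so the two actions are compared over real matrices.\<close>

lemma cl_action_eq_act:
  assumes "is_real_mat (\<pi> g)"
  shows "cl_action ginv \<pi> \<rho> g f = act (\<rho> (ginv g)) (\<pi> g) f"
proof -
  have "cl_letter ginv \<pi> \<rho> g = act_letter (\<rho> (ginv g)) (\<pi> g)"
    by (rule ext) (simp add: cl_letter_def act_letter_def Phi_eq_PhiC omega_def o_def realmat_mult_axis [OF assms])
  then show ?thesis
    by (simp add: cl_action_def cl_word_def act_def kext_def)
qed

section \<open>Boost matrices in an orthonormal frame, over any commutative ring\<close>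

section \<open>Boosts\<close>

text \<open>\<open>boost t s c h\<close> is \<open>((c, h), (h, c))\<close> on the plane of the indices \<open>t, s\<close>.\<close>
definition boost :: "'d \<Rightarrow> 'd \<Rightarrow> 'a \<Rightarrow> 'a \<Rightarrow> 'a::comm_ring_1^'d^'d" where
  "boost t s c h = (\<chi> i j. if i = j then (if i = t \<or> i = s then c else 1)
     else if i = t \<and> j = s \<or> i = s \<and> j = t then h else 0)"

definition signature :: "'d \<Rightarrow> 'a::comm_ring_1^'d^'d" where
  "signature t = (\<chi> i j. if i = j then (if i = t then 1 else -1) else 0)"

lemma sum_boost:
  fixes f :: "'d::finite \<Rightarrow> 'a::comm_ring_1"
  assumes "t \<noteq> s"
  shows "(\<Sum>j\<in>UNIV. boost t s c h $ i $ j * f j)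
    = (if i = t then c * f t + h * f s else if i = s then h * f t + c * f s else f i)"
proof -
  have "(\<Sum>j\<in>UNIV. boost t s c h $ i $ j * f j)
    = (\<Sum>j\<in>UNIV. (if j = i then (if i = t \<or> i = s then c else 1) * f i else 0)
        + ((if j = s then (if i = t then h * f s else 0) else 0)
         + (if j = t then (if i = s then h * f t else 0) else 0)))"
    using assms by (intro sum.cong) (auto simp: boost_def)
  also have "\<dots> = (if i = t then c * f t + h * f s else if i = s then h * f t + c * f s else f i)"
    unfolding sum.distrib using assms by (simp add: algebra_simps)
  finally show ?thesis .
qed

lemma boost_vector:
  assumes "t \<noteq> s"
  shows "(boost t s c h *v x) $ i
    = (if i = t then c * x $ t + h * x $ s else if i = s then h * x $ t + c * x $ s else x $ i)"
  by (simp add: matrix_vector_mult_def sum_boost [OF assms])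

lemma signature_vector: "(signature t *v x) $ i = (if i = t then 1 else - 1) * x $ i"
  by (simp add: matrix_vector_mult_def signature_def if_distrib [of "\<lambda>x. x * _"] cong: if_cong)

lemma boost_mult:
  assumes "t \<noteq> s"
  shows "boost t s c h ** boost t s c' h' = boost t s (c * c' + h * h') (c * h' + h * c')"
  unfolding vec_eq_iff matrix_matrix_mult_def
  using assms by (simp add: sum_boost) (auto simp: boost_def algebra_simps)

lemma boost_one: "boost t s 1 0 = mat 1"
  by (simp add: vec_eq_iff boost_def mat_def)

lemma transpose_boost: "transpose (boost t s c h) = boost t s c h"
  by (auto simp: vec_eq_iff transpose_def boost_def)

text \<open>Moving a boost past the signature matrix flips the sign of \<open>h\<close>, and the
  boosts with \<open>h\<close> and \<open>- h\<close> are mutually inverse if c^2 - h^2 = 1.\<close>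

lemma boost_signature:
  fixes c h :: "'a::comm_ring_1"
  assumes "t \<noteq> (s::'d::finite)" "c * c - h * h = 1"
  shows "transpose (boost t s c h) ** signature t ** boost t s c h = signature t"
proof -
  have "signature t ** boost t s c h = boost t s c (- h) ** (signature t :: 'a^'d^'d)"
  proof -
    have "(signature t ** boost t s c h :: 'a^'d^'d) $ i $ j = (if i = t then 1 else - 1) * boost t s c h $ i $ j" for i j
      by (simp add: signature_def matrix_matrix_mult_def if_distrib [of "\<lambda>x. x * _"] cong: if_cong)
    then show ?thesis
      unfolding vec_eq_iff using assms(1)
      by (simp add: matrix_matrix_mult_def sum_boost) (auto simp: boost_def signature_def)
  qed
  then have "transpose (boost t s c h) ** signature t ** boost t s c h
      = boost t s c h ** boost t s c (- h) ** signature t"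
    by (simp add: transpose_boost flip: matrix_mul_assoc)
  also have "\<dots> = signature t"
    using assms by (simp add: boost_mult boost_one algebra_simps)
  finally show ?thesis .
qed

section \<open>Transfer between real and complex isometries\<close>

section \<open>Real and complex matrices\<close>

lemma cmat_mult: "cmat (A ** B) = cmat A ** cmat B"
  by (simp add: cmat_def matrix_matrix_mult_def vec_eq_iff)

lemma cmat_transpose: "cmat (transpose A) = transpose (cmat A)"
  by (simp add: cmat_def transpose_def vec_eq_iff)

lemma cmat_mat1: "cmat (mat 1) = mat 1"
  by (auto simp: cmat_def mat_def vec_eq_iff)

lemma cmat_signature: "cmat (signature t) = signature t"
  by (simp add: cmat_def signature_def vec_eq_iff)

lemma cmat_boost: "cmat (boost t s c h) = boost t s (of_real c) (of_real h)"
  by (simp add: cmat_def boost_def vec_eq_iff)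

lemma realmat_cmat [simp]: "realmat (cmat A) = A"
  by (simp add: cmat_def realmat_def vec_eq_iff)

lemma is_real_mat_cmat [simp]: "is_real_mat (cmat A)"
  by (simp add: cmat_def is_real_mat_def)

lemma cmat_realmat: "is_real_mat A \<Longrightarrow> cmat (realmat A) = A"
  by (simp add: cmat_def realmat_def vec_eq_iff is_real_mat_def complex_eq_iff)

lemma cmat_eq_iff [simp]: "cmat A = cmat B \<longleftrightarrow> A = B"
  by (metis realmat_cmat)

lemma LC_mult: "A \<in> LC \<eta> \<Longrightarrow> B \<in> LC \<eta> \<Longrightarrow> A ** B \<in> LC \<eta>"
  by (simp add: LC_def matrix_transpose_mul det_mul)
    (metis matrix_mul_assoc)

lemma inner_transpose_vector: "v \<bullet> (transpose A *v x) = (A *v v) \<bullet> x" for A :: "real^'n^'m"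
  by (metis dot_lmul_matrix inner_commute transpose_matrix_vector)

lemma LC_isometry:
  assumes "cmat A \<in> LC \<eta>"
  shows "eta_form \<eta> (A *v v) (A *v w) = eta_form \<eta> v w"
proof -
  have "transpose A ** \<eta> ** A = \<eta>"
    using assms unfolding LC_def
    by (simp add: cmat_transpose [symmetric] cmat_mult [symmetric])
  then have "v \<bullet> (\<eta> *v w) = v \<bullet> (transpose A *v (\<eta> *v (A *v w)))"
    by (simp add: matrix_vector_mul_assoc matrix_mul_assoc)
  then show ?thesis
    unfolding eta_form_def by (simp only: inner_transpose_vector)
qed

section \<open>Timelike vectors, the time component and orthochronous isometries\<close>

section \<open>Time orientation\<close>

lemma add_mult_pos_if_abs_less:
  fixes m r :: real
  assumes "\<bar>r\<bar> < \<bar>m\<bar>" shows "0 < (m + r) * m"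
proof (cases "m > 0")
  case True
  with assms show ?thesis by (intro mult_pos_pos) linarith+
next
  case False
  with assms show ?thesis by (intro mult_neg_neg) linarith+
qed

text \<open>Reverse Cauchy--Schwarz: \<open>a\<close>, \<open>b\<close> are the time components.\<close>
lemma reverse_Cauchy_Schwarz_sign:
  fixes a b :: real and x y :: "'d \<Rightarrow> real"
  assumes "(\<Sum>i\<in>S. (x i)\<^sup>2) < a\<^sup>2" "(\<Sum>i\<in>S. (y i)\<^sup>2) < b\<^sup>2"
  shows "0 < (a * b - (\<Sum>i\<in>S. x i * y i)) * (a * b)"
proof -
  have "(\<Sum>i\<in>S. x i * y i)\<^sup>2 \<le> (\<Sum>i\<in>S. (x i)\<^sup>2) * (\<Sum>i\<in>S. (y i)\<^sup>2)"
    by (rule Cauchy_Schwarz_ineq_sum)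
  also have "\<dots> < a\<^sup>2 * b\<^sup>2"
    using assms by (intro mult_strict_mono') (auto intro: sum_nonneg)
  also have "\<dots> = (a * b)\<^sup>2"
    by (simp add: power_mult_distrib)
  finally have "\<bar>\<Sum>i\<in>S. x i * y i\<bar> < \<bar>a * b\<bar>"
    by (metis abs_le_square_iff not_le)
  then show ?thesis
    using add_mult_pos_if_abs_less [of "- (\<Sum>i\<in>S. x i * y i)" "a * b"] by simp
qed

text \<open>The columns of \<open>P\<close> are an orthonormal frame with time index
  \<open>t\<close>, and \<open>Q\<close> computes coordinates in it. The indices \<open>t\<close>
  and \<open>s\<close> span the plane of the boosts.\<close>

locale lorentz_frame =
  fixes \<eta> :: "real^'d::finite^'d" and P Q :: "real^'d^'d" and t s :: 'd
  assumes PQ: "P ** Q = mat 1" and QP: "Q ** P = mat 1"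
    and diag: "transpose P ** \<eta> ** P = signature t" and ts: "t \<noteq> s"
begin

lemma eta_eq: "\<eta> = transpose Q ** signature t ** Q"
proof -
  have "transpose Q ** signature t ** Q = (transpose Q ** transpose P) ** \<eta> ** (P ** Q)"
    by (simp add: matrix_mul_assoc flip: diag)
  also have "transpose Q ** transpose P = mat 1"
    by (simp add: PQ flip: matrix_transpose_mul)
  finally show ?thesis
    by (simp add: PQ)
qed

definition time :: "real^'d \<Rightarrow> real" where "time v = (Q *v v) $ t"

lemma eta_form_coords:
  "eta_form \<eta> v w = time v * time w - (\<Sum>i\<in>-{t}. (Q *v v) $ i * (Q *v w) $ i)"
proof -
  have "eta_form \<eta> v w = (Q *v v) \<bullet> (signature t *v (Q *v w))"
    unfolding eta_form_def eta_eq
    by (simp only: matrix_vector_mul_assoc [symmetric] inner_transpose_vector)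
  also have "\<dots> = (\<Sum>i\<in>UNIV. (Q *v v) $ i * ((if i = t then 1 else - 1) * (Q *v w) $ i))"
    by (simp add: inner_vec_def signature_vector)
  also have "\<dots> = time v * time w + (\<Sum>i\<in>-{t}. (Q *v v) $ i * ((if i = t then 1 else - 1) * (Q *v w) $ i))"
    by (subst sum.remove [of _ t]) (auto simp: time_def Compl_eq_Diff_UNIV)
  also have "(\<Sum>i\<in>-{t}. (Q *v v) $ i * ((if i = t then 1 else - 1) * (Q *v w) $ i))
      = - (\<Sum>i\<in>-{t}. (Q *v v) $ i * (Q *v w) $ i)"
    unfolding sum_negf [symmetric] by (rule sum.cong) auto
  finally show ?thesis by simp
qed

lemma eta_form_sign:
  assumes "eta_form \<eta> v v > 0" "eta_form \<eta> w w > 0"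
  shows "eta_form \<eta> v w * (time v * time w) > 0"
  using reverse_Cauchy_Schwarz_sign
    [of "\<lambda>i. (Q *v v) $ i" "- {t}" "time v" "\<lambda>i. (Q *v w) $ i" "time w"] assms
  by (simp add: eta_form_coords power2_eq_square)

text \<open>An isometry keeps \<open>A *v v\<close> timelike, so \<open>eta_form_sign\<close>
  replaces the sign of the form by signs of time components, which are easy to follow through
  products of matrices.\<close>

lemma orthochronous_iff_time:
  assumes "cmat A \<in> LC \<eta>"
  shows "orthochronous \<eta> A \<longleftrightarrow> (\<forall>v. eta_form \<eta> v v > 0 \<longrightarrow> time v * time (A *v v) > 0)"
proof -
  have "eta_form \<eta> v (A *v v) > 0 \<longleftrightarrow> time v * time (A *v v) > 0" if "eta_form \<eta> v v > 0" for v
    using eta_form_sign [of v "A *v v"] that LC_isometry [OF assms]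
    by (metis zero_less_mult_pos zero_less_mult_pos2)
  then show ?thesis
    by (auto simp: orthochronous_def)
qed

text \<open>The negated definition supplies a single reversed timelike \<open>v\<close>. Since
  \<open>A\<close> preserves the form, \<open>v\<close> and \<open>w\<close> lie in the same cone
  exactly if their images do, so \<open>w\<close> is reversed too.\<close>

lemma not_orthochronous_time:
  assumes "cmat A \<in> LC \<eta>" "\<not> orthochronous \<eta> A" "eta_form \<eta> w w > 0"
  shows "time w * time (A *v w) < 0"
proof -
  obtain v where v: "eta_form \<eta> v v > 0" "\<not> time v * time (A *v v) > 0"
    using assms orthochronous_iff_time by auto
  have iso: "eta_form \<eta> (A *v x) (A *v y) = eta_form \<eta> x y" for x y
    by (rule LC_isometry [OF assms(1)])
  have "eta_form \<eta> v w * (time v * time w) > 0"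
    "eta_form \<eta> v w * (time (A *v v) * time (A *v w)) > 0"
    "eta_form \<eta> v (A *v v) * (time v * time (A *v v)) > 0"
    using eta_form_sign [OF v(1) assms(3)] eta_form_sign [of "A *v v" "A *v w"]
      eta_form_sign [of v "A *v v"] v assms(3) by (auto simp: iso)
  then show ?thesis
    using v(2) by (auto simp: zero_less_mult_iff mult_less_0_iff)
qed

section \<open>Boosts of complex rapidity and the half turn\<close>

definition cboost :: "complex \<Rightarrow> complex^'d^'d" where
  "cboost z = cmat P ** boost t s (cosh z) (sinh z) ** cmat Q"

lemma cPQ: "cmat P ** cmat Q = mat 1" "cmat Q ** cmat P = mat 1"
  by (simp_all add: PQ QP cmat_mat1 flip: cmat_mult)

text \<open>These are the addition theorems of \<open>cosh\<close> and \<open>sinh\<close>. The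
  resulting one-parameter group allows large rapidities to be reached by powers of small
  ones.\<close>

lemma cboost_add: "cboost (z + w) = cboost z ** cboost w"
proof -
  have "cboost z ** cboost w = cmat P ** boost t s (cosh z) (sinh z) ** (cmat Q ** cmat P)
      ** boost t s (cosh w) (sinh w) ** cmat Q"
    by (simp add: cboost_def matrix_mul_assoc)
  also have "\<dots> = cmat P ** (boost t s (cosh z) (sinh z) ** boost t s (cosh w) (sinh w)) ** cmat Q"
    by (simp add: cPQ matrix_mul_assoc)
  also have "\<dots> = cboost (z + w)"
    by (simp add: boost_mult [OF ts] cboost_def cosh_add sinh_add algebra_simps)
  finally show ?thesis ..
qed

lemma cboost_zero: "cboost 0 = mat 1"
  by (simp add: cboost_def boost_one cPQ)

lemma cboost_isometry: "transpose (cboost z) ** cmat \<eta> ** cboost z = cmat \<eta>"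
proof -
  have "cosh z * cosh z - sinh z * sinh z = 1"
    using cosh_square_eq [of z] by (simp add: power2_eq_square)
  note N = boost_signature [OF ts this]
  have "transpose (cboost z) ** cmat \<eta> ** cboost z
      = transpose (cmat Q) ** transpose (boost t s (cosh z) (sinh z)) ** transpose (cmat P)
        ** (transpose (cmat Q) ** signature t ** cmat Q)
        ** (cmat P ** boost t s (cosh z) (sinh z) ** cmat Q)"
    unfolding cboost_def eta_eq
    by (simp add: matrix_transpose_mul cmat_mult cmat_transpose cmat_signature matrix_mul_assoc)
  also have "\<dots> = transpose (cmat Q) ** (transpose (boost t s (cosh z) (sinh z)) ** (transpose (cmat P) ** transpose (cmat Q))
        ** signature t ** (cmat Q ** cmat P) ** boost t s (cosh z) (sinh z)) ** cmat Q"
    by (simp add: matrix_mul_assoc)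
  also have "transpose (cmat P) ** transpose (cmat Q) = mat 1"
    by (simp add: cPQ flip: matrix_transpose_mul)
  finally show ?thesis
    by (simp add: cPQ N eta_eq cmat_mult cmat_transpose cmat_signature)
qed

text \<open>\<open>cboost z\<close> is the square of the isometry \<open>cboost (z / 2)\<close>, and isometries have determinant \<open>\<plusminus>1\<close>.\<close>
lemma cboost_in_LC: "cboost z \<in> LC \<eta>"
proof -
  have "det (cmat \<eta>) \<noteq> 0"
  proof -
    have "transpose (cmat P) ** cmat \<eta> ** cmat P = signature t"
      using diag by (metis cmat_mult cmat_transpose cmat_signature)
    moreover have "signature t ** signature t = (mat 1 :: complex^'d^'d)"
      by (auto simp: vec_eq_iff matrix_matrix_mult_def signature_def mat_def if_distrib [of "\<lambda>x. x * _"] cong: if_cong)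
    ultimately have "det (transpose (cmat P)) * det (cmat \<eta>) * det (cmat P) * det (signature t :: complex^'d^'d) = 1"
      by (metis det_mul det_I)
    then show ?thesis by auto
  qed
  moreover have "det (cboost (z / 2)) * det (cmat \<eta>) * det (cboost (z / 2)) = det (cmat \<eta>)"
    by (metis cboost_isometry det_mul det_transpose)
  ultimately have "det (cboost (z / 2)) * det (cboost (z / 2)) = 1"
    by (simp add: mult.commute mult.left_commute)
  moreover have "cboost z = cboost (z / 2) ** cboost (z / 2)"
    by (simp flip: cboost_add)
  ultimately have "det (cboost z) = 1"
    by (simp add: det_mul)
  then show ?thesis
    by (simp add: LC_def cboost_isometry)
qed

definition half_turn :: "real^'d^'d" where "half_turn = P ** boost t s (- 1) 0 ** Q"

text \<open>Both signs are recorded: the lifted element will lie over the first value, while its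
  inverse, whose action is studied, lies over the second.\<close>

lemma cboost_pi: "cboost (\<i> * of_real pi) = cmat half_turn" "cboost (- (\<i> * of_real pi)) = cmat half_turn"
  by (simp_all add: cboost_def half_turn_def cmat_mult cmat_boost cosh_def sinh_def exp_minus scaleR_conv_of_real)

lemma time_half_turn: "time (half_turn *v v) = - time v"
proof -
  have "Q *v (half_turn *v v) = (Q ** P) *v (boost t s (- 1) 0 *v (Q *v v))"
    by (simp add: half_turn_def matrix_vector_mul_assoc matrix_mul_assoc)
  then show ?thesis
    by (simp add: QP time_def boost_vector [OF ts])
qed

lemma cmat_half_turn_in_LC: "cmat half_turn \<in> LC \<eta>"
  using cboost_in_LC [of "\<i> * of_real pi"] by (simp add: cboost_pi)

text \<open>The half turn negates the time component and keeps vectors timelike; \<open>A\<close>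
  reverses every timelike vector, so the two signs cancel.\<close>

lemma Ldown_mult_half_turn:
  assumes "A \<in> Ldown \<eta>"
  shows "A ** cmat half_turn \<in> Lup \<eta>"
proof -
  define A' where "A' = realmat A"
  have A: "A = cmat A'" and LC: "cmat A' \<in> LC \<eta>" and nonorth: "\<not> orthochronous \<eta> A'"
    using assms by (auto simp: Ldown_def A'_def cmat_realmat)
  have "time v * time ((A' ** half_turn) *v v) > 0" if v: "eta_form \<eta> v v > 0" for v
  proof -
    have "time (half_turn *v v) * time (A' *v (half_turn *v v)) < 0"
      using not_orthochronous_time [OF LC nonorth] LC_isometry [OF cmat_half_turn_in_LC] v by simp
    then show ?thesis
      by (simp add: time_half_turn matrix_vector_mul_assoc)
  qed
  moreover have "cmat (A' ** half_turn) \<in> LC \<eta>"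
    unfolding cmat_mult by (intro LC_mult LC cmat_half_turn_in_LC)
  ultimately show ?thesis
    by (simp add: Lup_def A orthochronous_iff_time flip: cmat_mult)
qed

text \<open>For timelike \<open>v\<close> the time component dominates the component along
  \<open>s\<close>, and \<open>cosh x\<close> dominates \<open>sinh x\<close>; hence the boosted
  time component keeps its sign.\<close>

lemma cboost_real_in_Lup: "cboost (of_real x) \<in> Lup \<eta>"
proof -
  define A where "A = P ** boost t s (cosh x) (sinh x) ** Q"
  have cboost: "cboost (of_real x) = cmat A"
    by (simp add: cboost_def A_def cmat_mult cmat_boost cosh_def sinh_def scaleR_conv_of_real exp_of_real flip: of_real_minus)
  have LC: "cmat A \<in> LC \<eta>"
    using cboost_in_LC [of "of_real x"] by (simp add: cboost)
  have "time v * time (A *v v) > 0" if v: "eta_form \<eta> v v > 0" for v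
  proof -
    define y where "y = (Q *v v) $ s"
    have "Q *v (A *v v) = (Q ** P) *v (boost t s (cosh x) (sinh x) *v (Q *v v))"
      by (simp add: A_def matrix_vector_mul_assoc matrix_mul_assoc)
    then have T: "time (A *v v) = cosh x * time v + sinh x * y"
      by (simp add: QP time_def y_def boost_vector [OF ts])
    have "y\<^sup>2 \<le> (\<Sum>i\<in>-{t}. ((Q *v v) $ i)\<^sup>2)"
      unfolding y_def using ts by (intro member_le_sum) auto
    then have "y\<^sup>2 < (time v)\<^sup>2"
      using v by (simp add: eta_form_coords power2_eq_square)
    then have y: "\<bar>y\<bar> < \<bar>time v\<bar>"
      by (metis abs_le_square_iff not_le)
    have sh: "\<bar>sinh x\<bar> < cosh x"
      using sinh_less_cosh_real [of x] sinh_less_cosh_real [of "- x"] by (simp add: abs_if)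
    have "\<bar>sinh x * y\<bar> < \<bar>cosh x * time v\<bar>"
      unfolding abs_mult using y sh by (intro mult_strict_mono') (auto simp: cosh_real_nonneg)
    then have "(cosh x * time v + sinh x * y) * (cosh x * time v) > 0"
      by (rule add_mult_pos_if_abs_less)
    then have "cosh x * (time v * (cosh x * time v + sinh x * y)) > 0"
      by (simp only: mult_ac)
    then show ?thesis
      unfolding T by (rule zero_less_mult_pos) simp
  qed
  then show ?thesis
    by (simp add: Lup_def cboost LC orthochronous_iff_time)
qed

end

lemma lorentzian_frame:
  fixes \<eta> :: "real^'d::finite^'d"
  assumes "lorentzian \<eta>" "CARD('d) \<ge> 2"
  obtains P Q t s where "lorentz_frame \<eta> P Q t s"
proof -
  obtain P :: "real^'d^'d" and t where P: "invertible P" "transpose P ** \<eta> ** P = signature t"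
    using assms(1) unfolding lorentzian_def signature_def by blast
  have "\<exists>s. t \<noteq> s"
  proof (rule ccontr)
    assume "\<not> (\<exists>s. t \<noteq> s)"
    then have "(UNIV :: 'd set) = {t}" by auto
    then have "CARD('d) = card {t}" by (simp only:)
    then show False using assms(2) by simp
  qed
  then obtain s where "t \<noteq> s" ..
  moreover obtain Q where "P ** Q = mat 1" "Q ** P = mat 1"
    using P(1) unfolding invertible_def by blast
  ultimately show ?thesis
    using P(2) that unfolding lorentz_frame_def by blast
qed

section \<open>Separation of points from affine subspaces and the identity theorem\<close>

section \<open>Holomorphic continuation inside an affine subspace\<close>

lemma vector_space_kscale: "vector_space (kscale :: complex \<Rightarrow> ('k,'d) kalg \<Rightarrow> _)"
  by unfold_locales auto

text \<open>Translate \<open>D\<close> by \<open>f0\<close> to a linear subspace, adjoin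
  \<open>x - f0\<close> to a basis of it, and let \<open>\<phi>\<close> be 1 on the new vector and 0
  on the basis.\<close>

lemma affine_separation:
  fixes D :: "('k,'d) kalg set"
  assumes affine: "\<And>f g c. f \<in> D \<Longrightarrow> g \<in> D \<Longrightarrow> kscale (1 - c) f + kscale c g \<in> D"
    and f0: "f0 \<in> D" and x: "x \<notin> D"
  obtains \<phi> :: "('k,'d) kalg \<Rightarrow> complex"
  where "Vector_Spaces.linear kscale (*) \<phi>" "\<And>f. f \<in> D \<Longrightarrow> \<phi> f = \<phi> f0" "\<phi> x \<noteq> \<phi> f0"
proof -
  interpret vs: vector_space "kscale :: complex \<Rightarrow> ('k,'d) kalg \<Rightarrow> _"
    by (rule vector_space_kscale)
  interpret pair: vector_space_pair "kscale :: complex \<Rightarrow> ('k,'d) kalg \<Rightarrow> _" "(*) :: complex \<Rightarrow> _"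
    by unfold_locales
  let ?D0 = "(\<lambda>f. f - f0) ` D"
  have "vs.subspace ?D0"
  proof (rule vs.subspaceI)
    show "0 \<in> ?D0" using f0 by (auto intro: image_eqI [of _ _ f0])
    have scale: "kscale c (f - f0) \<in> ?D0" if "f \<in> D" for c f
    proof (rule image_eqI)
      show "kscale (1 - c) f0 + kscale c f \<in> D" by (rule affine [OF f0 that])
      show "kscale c (f - f0) = kscale (1 - c) f0 + kscale c f - f0"
        by (simp add: vs.scale_left_diff_distrib vs.scale_right_diff_distrib)
    qed
    then show "kscale c g \<in> ?D0" if "g \<in> ?D0" for c g
      using that by auto
    show "g + h \<in> ?D0" if "g \<in> ?D0" "h \<in> ?D0" for g h
    proof -
      obtain a b where ab: "g = a - f0" "h = b - f0" "a \<in> D" "b \<in> D"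
        using \<open>g \<in> ?D0\<close> \<open>h \<in> ?D0\<close> by blast
      \<comment> \<open>Only affine combinations stay in \<open>D\<close>, so the sum is obtained as
        twice the translated midpoint.\<close>
      let ?m = "kscale (1 - 1/2) a + kscale (1/2) b"
      have "kscale 2 (?m - f0) = g + h"
        by (simp add: ab vs.scale_right_diff_distrib kscale_simps(4)) (simp add: fun_eq_iff kscale_def plus_fun_apply)
      moreover have "?m \<in> D" using ab affine by blast
      ultimately show ?thesis using scale [of ?m 2] by simp
    qed
  qed
  then obtain Bs where Bs: "Bs \<subseteq> ?D0" "vs.independent Bs" "?D0 \<subseteq> vs.span Bs"
    using vs.maximal_independent_subset by blast
  then have span: "vs.span Bs = ?D0"
    using \<open>vs.subspace ?D0\<close> by (metis subset_antisym vs.span_minimal)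
  have "x - f0 \<notin> ?D0" using x by auto
  then have ind: "vs.independent (insert (x - f0) Bs)"
    using Bs span by (simp add: vs.independent_insert)
  obtain \<phi> where \<phi>: "Vector_Spaces.linear kscale (*) \<phi>"
    "\<forall>y\<in>insert (x - f0) Bs. \<phi> y = (if y = x - f0 then 1 else 0)"
    using pair.linear_independent_extend [OF ind, of "\<lambda>y. if y = x - f0 then 1 else 0"] by blast
  interpret \<phi>: Vector_Spaces.linear kscale "(*)" \<phi> by (rule \<phi>(1))
  have "\<phi> y = 0" if "y \<in> Bs" for y
    using that \<phi>(2) span \<open>x - f0 \<notin> ?D0\<close> vs.span_base by fastforce
  then have "\<phi> y = 0" if "y \<in> vs.span Bs" for y
    using that pair.linear_eq_0_on_span \<phi>(1) by blast
  then have "\<phi> f = \<phi> f0" if "f \<in> D" for f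
    using that by (force simp: span \<phi>.diff)
  moreover have "\<phi> x - \<phi> f0 = 1"
    using \<phi>(2) by (simp add: \<phi>.diff)
  ultimately show ?thesis
    using that [OF \<phi>(1)] by fastforce
qed

text \<open>A functional separating \<open>F z\<close> from \<open>D\<close> would be constant along
  the real part of the curve, hence on the whole disc. As \<open>T\<close> is finite, its composite
  with \<open>F\<close> is a finite sum of holomorphic functions, and no continuity of the
  functional is involved.\<close>

lemma holomorphic_curve_in_affine:
  fixes D :: "('k,'d) kalg set" and F :: "complex \<Rightarrow> ('k,'d) kalg"
  assumes affine: "\<And>f g c. f \<in> D \<Longrightarrow> g \<in> D \<Longrightarrow> kscale (1 - c) f + kscale c g \<in> D"
    and T: "finite T" "\<And>z w. w \<notin> T \<Longrightarrow> F z w = 0"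
    and holo: "\<And>w. (\<lambda>z. F z w) holomorphic_on ball 0 r"
    and real: "\<And>x. \<bar>x\<bar> < r \<Longrightarrow> F (of_real x) \<in> D"
    and z: "z \<in> ball 0 r"
  shows "F z \<in> D"
proof (rule ccontr)
  assume notin: "F z \<notin> D"
  \<comment> \<open>A set of real points accumulating at 0, as the identity theorem
    requires.\<close>
  let ?A = "complex_of_real ` {0<..<r}"
  have r: "r > 0" using z by (metis ball_eq_empty empty_iff not_le)
  have F0: "F 0 \<in> D" using real [of 0] r by simp
  obtain \<phi> :: "('k,'d) kalg \<Rightarrow> complex" where \<phi>: "Vector_Spaces.linear kscale (*) \<phi>"
    "\<And>f. f \<in> D \<Longrightarrow> \<phi> f = \<phi> (F 0)" "\<phi> (F z) \<noteq> \<phi> (F 0)"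
    using affine_separation [of D "F 0" "F z"] affine F0 notin by blast
  interpret \<phi>: Vector_Spaces.linear kscale "(*)" \<phi> by (rule \<phi>(1))
  have "\<phi> (F z) = \<phi> (\<Sum>w\<in>T. kscale (F z w) (kword w))" for z
    using kelem_expand [of T "F z"] T by metis
  then have expand: "\<phi> (F z) = (\<Sum>w\<in>T. F z w * \<phi> (kword w))" for z
    by (simp add: \<phi>.sum \<phi>.scale)
  have "(\<lambda>z. \<phi> (F z) - \<phi> (F 0)) holomorphic_on ball 0 r"
    unfolding expand by (intro holomorphic_intros holo)
  moreover have "0 islimpt ?A"
  proof (rule islimptI)
    fix S :: "complex set" assume "0 \<in> S" "open S"
    then obtain e where e: "e > 0" "ball 0 e \<subseteq> S" using openE by blast
    define x where "x = min e r / 2"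
    have x: "0 < x" "x < e" "x < r" using e r by (auto simp: x_def min_def)
    then have "of_real x \<in> S" by (intro subsetD [OF e(2)]) auto
    then show "\<exists>y\<in>?A. y \<in> S \<and> y \<noteq> 0"
      using x by (intro bexI [of _ "of_real x"]) auto
  qed
  moreover have "\<phi> (F w) - \<phi> (F 0) = 0" if "w \<in> ?A" for w
    using that \<phi>(2) real by auto
  moreover have "?A \<subseteq> ball (0::complex) r" by auto
  ultimately have "\<phi> (F z) - \<phi> (F 0) = 0"
    using z r analytic_continuation [of "\<lambda>z. \<phi> (F z) - \<phi> (F 0)" "ball 0 r" "?A" 0 z]
    by simp
  then show False using \<phi>(3) by simp
qed

section \<open>Holomorphic matrix-valued functions along holomorphic curves\<close>

lemma has_derivative_vec_componentwise:
  fixes f :: "'a::real_normed_vector \<Rightarrow> 'b::euclidean_space^'n::finite"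
  assumes "\<And>i. ((\<lambda>x. f x $ i) has_derivative (\<lambda>h. f' h $ i)) (at x within S)"
  shows "(f has_derivative f') (at x within S)"
  unfolding has_derivative_componentwise_within [of f]
  using assms by (auto simp: Basis_vec_def inner_axis intro!: has_derivative_inner_left)

lemma holo_on_compose:
  fixes X :: "complex \<Rightarrow> complex^'a::finite^'b::finite" and F :: "complex^'a^'b \<Rightarrow> complex^'c::finite^'e::finite"
  assumes F: "holo_on Om F" and X: "\<And>i j. (\<lambda>z. X z $ i $ j) holomorphic_on S"
    and S: "open S" "X ` S \<subseteq> Om"
  shows "(\<lambda>z. F (X z) $ i $ j) holomorphic_on S"
  unfolding holomorphic_on_open [OF S(1)]
proof
  fix z assume z: "z \<in> S"
  have "\<exists>d. ((\<lambda>z. X z $ i $ j) has_field_derivative d) (at z)" for i j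
    using X [of i j] z by (simp add: holomorphic_on_open [OF S(1)])
  then obtain d where d: "\<And>i j. ((\<lambda>z. X z $ i $ j) has_field_derivative d i j) (at z)"
    by metis
  define d' where "d' = (\<chi> i j. d i j)"
  have "((\<lambda>z. \<chi> i. \<chi> j. X z $ i $ j) has_derivative (\<lambda>h. \<chi> i. \<chi> j. d i j * h)) (at z)"
    using d unfolding has_field_derivative_def by (intro has_derivative_vec_componentwise) simp
  then have "(X has_derivative (\<lambda>h. cscale_mat h d')) (at z)"
    by (simp add: cscale_mat_def d'_def mult.commute)
  moreover obtain F' where F': "(F has_derivative F') (at (X z))"
    "\<And>v. F' (cscale_mat \<i> v) = cscale_mat \<i> (F' v)"
    using F S z unfolding holo_on_def by blast
  ultimately have "((\<lambda>z. F (X z)) has_derivative (\<lambda>h. F' (cscale_mat h d'))) (at z)"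
    using has_derivative_compose by blast
  then have "((\<lambda>z. F (X z) $ i $ j) has_derivative (\<lambda>h. F' (cscale_mat h d') $ i $ j)) (at z)"
    by (intro bounded_linear.has_derivative [OF bounded_linear_vec_nth])
  moreover have "F' (cscale_mat h d') $ i $ j = F' d' $ i $ j * h" for h
  proof -
    have lin: "linear F'" using F'(1) by (simp add: has_derivative_linear)
    \<comment> \<open>Splitting \<open>h\<close> into real and imaginary parts turns real linearity
      of \<open>F'\<close> and its commutation with \<open>\<i>\<close> into complex
      linearity.\<close>
    have "cscale_mat h d' = Re h *\<^sub>R d' + Im h *\<^sub>R cscale_mat \<i> d'"
      by (simp add: cscale_mat_def vec_eq_iff complex_eq_iff algebra_simps)
    then have "F' (cscale_mat h d') = Re h *\<^sub>R F' d' + Im h *\<^sub>R cscale_mat \<i> (F' d')"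
      by (simp add: linear_add [OF lin] linear_scale [OF lin] F'(2))
    then show ?thesis
      by (simp add: cscale_mat_def complex_eq_iff algebra_simps)
  qed
  ultimately show "\<exists>f'. ((\<lambda>z. F (X z) $ i $ j) has_field_derivative f') (at z)"
    unfolding has_field_derivative_def by auto
qed

section \<open>Lifting boosts to the cover and reaching the time-reversing elements\<close>

section \<open>The covering group\<close>

context lorentz_frame
begin

lemma cboost_entry_holomorphic: "(\<lambda>z. cboost z $ i $ j) holomorphic_on S"
proof -
  have "cosh holomorphic_on S" "sinh holomorphic_on S"
    unfolding cosh_field_def [abs_def] sinh_field_def [abs_def] by (auto intro!: holomorphic_intros)
  then have "(\<lambda>z. boost t s (cosh z) (sinh z) $ i $ j :: complex) holomorphic_on S" for i j
    unfolding boost_def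
    by (cases "i = j"; cases "i = t \<or> i = s"; cases "i = t \<and> j = s \<or> i = s \<and> j = t") auto
  then show ?thesis
    unfolding cboost_def matrix_matrix_mult_def by (auto intro!: holomorphic_intros)
qed

lemma continuous_on_cboost: "continuous_on S cboost"
proof -
  have "continuous_on S (\<lambda>z. \<chi> i. \<chi> j. cboost z $ i $ j)"
    by (intro continuous_on_vec_lambda holomorphic_on_imp_continuous_on cboost_entry_holomorphic)
  then show ?thesis by simp
qed

end

text \<open>Phrased for a pair of matrices, so that it also covers group elements over non-real
  matrices, where \<open>cl_action\<close> would see only the real part.\<close>

definition preserves :: "('k::finite,'d::finite) kalg set \<Rightarrow> complex^'k^'k \<Rightarrow> complex^'d^'d \<Rightarrow> bool" where
  "preserves D R M \<longleftrightarrow> (\<forall>f\<in>D. act R M f \<in> D)"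

lemma preserves_mult:
  assumes "\<And>f. f \<in> D \<Longrightarrow> kelem f" "preserves D R M" "preserves D R' M'"
  shows "preserves D (R' ** R) (M ** M')"
  unfolding preserves_def using assms by (simp add: preserves_def flip: act_act)

theorem theorem4:
  fixes \<eta> :: "real^'d::finite^'d"
    and G :: "'g::topological_space set" and mul :: "'g \<Rightarrow> 'g \<Rightarrow> 'g"
    and ginv :: "'g \<Rightarrow> 'g" and e :: 'g
    and \<pi> :: "'g \<Rightarrow> complex^'d^'d"
    and \<rho>hol :: "'g \<Rightarrow> complex^'k::finite^'k"
    and D :: "('k,'d) kalg set"
  assumes "CARD('d) \<ge> 3"
    and "lorentzian \<eta>"
    and "universal_cover \<eta> G mul ginv e \<pi>"
    and "holo_rep \<eta> G mul e \<pi> \<rho>hol"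
    and "holomorphic_fft D"
    and "invariant_under D (cl_action ginv \<pi> (\<lambda>g. \<rho>hol g) ` lift_up \<eta> G \<pi>)"
  shows "invariant_under D (cl_action ginv \<pi> (\<lambda>g. \<rho>hol g) ` lift_down \<eta> G \<pi>)"
proof -
  have grp: "e \<in> G" "\<And>x y. x \<in> G \<Longrightarrow> y \<in> G \<Longrightarrow> mul x y \<in> G" "\<And>x. x \<in> G \<Longrightarrow> ginv x \<in> G"
    "\<And>x y z. x \<in> G \<Longrightarrow> y \<in> G \<Longrightarrow> z \<in> G \<Longrightarrow> mul (mul x y) z = mul x (mul y z)"
    "\<And>x. x \<in> G \<Longrightarrow> mul e x = x" "\<And>x. x \<in> G \<Longrightarrow> mul x e = x"
    "\<And>x. x \<in> G \<Longrightarrow> mul (ginv x) x = e" "\<And>x. x \<in> G \<Longrightarrow> mul x (ginv x) = e"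
    and \<pi>_mul: "\<And>x y. x \<in> G \<Longrightarrow> y \<in> G \<Longrightarrow> \<pi> (mul x y) = \<pi> x ** \<pi> y"
    using assms(3) by (auto simp: universal_cover_def topgroup_def)
  have \<pi>_image: "\<pi> ` G = LC \<eta>"
    using assms(3) covering_space_imp_surjective [of G \<pi> "LC \<eta>"] by (simp add: universal_cover_def)
  have inv_unique: "y = ginv x" if "x \<in> G" "y \<in> G" "mul y x = e" for x y
    using that grp by metis
  have inv_inv: "ginv (ginv x) = x" if "x \<in> G" for x
    using inv_unique [of "ginv x" x] that grp by metis
  have inv_mul: "ginv (mul x y) = mul (ginv y) (ginv x)" if "x \<in> G" "y \<in> G" for x y
  proof -
    have "mul (mul (ginv y) (ginv x)) (mul x y) = mul (ginv y) (mul (mul (ginv x) x) y)"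
      using that by (simp add: grp(2-4))
    also have "\<dots> = e" using that by (simp add: grp)
    finally show ?thesis
      using inv_unique [of "mul x y" "mul (ginv y) (ginv x)"] that grp by simp
  qed
  have LC: "\<pi> x \<in> LC \<eta>" if "x \<in> G" for x using \<pi>_image that by blast
  \<comment> \<open>Multiplicativity makes \<open>\<pi> e\<close> idempotent, and an invertible
    idempotent is the identity.\<close>
  have \<pi>_e: "\<pi> e = mat 1"
  proof -
    have "det (\<pi> e) = 1" using LC grp(1) by (simp add: LC_def)
    then have "invertible (\<pi> e)" by (simp add: invertible_det_nz)
    then obtain A where "A ** \<pi> e = mat 1" by (auto simp: invertible_def)
    moreover have "\<pi> e ** \<pi> e = \<pi> e" using \<pi>_mul [of e e] grp by simp
    ultimately show ?thesis by (metis matrix_mul_assoc matrix_mul_lid)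
  qed
  have \<rho>: "\<rho>hol e = mat 1" "\<And>x y. x \<in> G \<Longrightarrow> y \<in> G \<Longrightarrow> \<rho>hol (mul x y) = \<rho>hol x ** \<rho>hol y"
    and holo: "holo_on_cover \<eta> G \<pi> \<rho>hol"
    using assms(4) by (auto simp: holo_rep_def)
  have affine: "\<And>f g c. f \<in> D \<Longrightarrow> g \<in> D \<Longrightarrow> kscale (1 - c) f + kscale c g \<in> D"
    and KC: "\<And>f. f \<in> D \<Longrightarrow> f \<in> KC" and kelem: "\<And>f. f \<in> D \<Longrightarrow> kelem f"
    using assms(5) by (auto simp: holomorphic_fft_def formal_field_theory_def)
  have up: "preserves D (\<rho>hol (ginv g)) (\<pi> g)" if "g \<in> G" "\<pi> g \<in> Lup \<eta>" for g
    using assms(6) that cl_action_eq_act [of \<pi> g ginv \<rho>hol]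
    by (auto simp: preserves_def invariant_under_def lift_up_def Lup_def)
  have "CARD('d) \<ge> 2" using assms(1) by simp
  then obtain P Q t s where "lorentz_frame \<eta> P Q t s"
    using lorentzian_frame [OF assms(2)] by blast
  then interpret lorentz_frame \<eta> P Q t s .
  obtain U Om F where U: "U \<subseteq> G" "inj_on \<pi> U" "open Om" "\<pi> ` U = Om \<inter> LC \<eta>" "e \<in> U"
    "holo_on Om F" "\<And>h. h \<in> U \<Longrightarrow> \<rho>hol h = F (\<pi> h)"
    using holo grp(1) unfolding holo_on_cover_def by (meson openin_imp_subset)
  have "mat 1 \<in> Om" using U \<pi>_e by (metis IntD1 imageI)
  then have "0 \<in> cboost -` Om" by (simp add: cboost_zero)
  moreover have "open (cboost -` Om)"
    using U(3) continuous_on_cboost by (simp add: open_vimage)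
  ultimately obtain r where r: "r > 0" "ball 0 r \<subseteq> cboost -` Om"
    using openE by blast
  \<comment> \<open>The lift of the boost through the sheet \<open>U\<close> at the identity, on
    which \<open>\<rho>hol\<close> is the ambient holomorphic \<open>F\<close> after
    \<open>\<pi>\<close>.\<close>
  define b where "b z = inv_into U \<pi> (cboost z)" for z
  have b: "b z \<in> U" "\<pi> (b z) = cboost z" if "z \<in> ball 0 r" for z
  proof -
    have "cboost z \<in> \<pi> ` U" using that r U(4) cboost_in_LC by auto
    then show "b z \<in> U" "\<pi> (b z) = cboost z"
      by (auto simp: b_def inv_into_into f_inv_into_f)
  qed
  have bG: "b z \<in> G" if "z \<in> ball 0 r" for z
    using b U(1) that by blast
  have \<pi>_inv_b: "\<pi> (ginv (b z)) = cboost (- z)" if "z \<in> ball 0 r" for z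
  proof -
    have "\<pi> (ginv (b z)) ** cboost z = mat 1"
      using \<pi>_mul [of "ginv (b z)" "b z"] grp bG b that \<pi>_e by simp
    moreover have "cboost z ** cboost (- z) = mat 1"
      by (simp add: cboost_zero flip: cboost_add)
    ultimately show ?thesis
      by (metis matrix_mul_assoc matrix_mul_lid matrix_mul_rid)
  qed
  \<comment> \<open>This is the action of \<open>ginv (b z)\<close>: its matrix on V is
    \<open>\<rho>hol (b z)\<close>, given by \<open>F\<close>. For \<open>b z\<close> itself the
    matrix would be \<open>\<rho>hol (ginv (b z))\<close>, whose argument need not lie in
    \<open>U\<close>.\<close>
  have preserves_b: "preserves D (\<rho>hol (b z)) (cboost (- z))" if z: "z \<in> ball 0 r" for z
    unfolding preserves_def
  proof
    fix f assume f: "f \<in> D"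
    have "(\<lambda>z. F (cboost z) $ i $ j) holomorphic_on ball 0 r" for i j
      by (rule holo_on_compose [OF U(6) cboost_entry_holomorphic]) (use r in auto)
    moreover have "(\<lambda>z. cboost (- z) $ i $ j) holomorphic_on ball 0 r" for i j
      using holomorphic_on_compose [of uminus "ball 0 r" "\<lambda>z. cboost z $ i $ j"]
      by (simp add: o_def cboost_entry_holomorphic holomorphic_on_minus)
    ultimately obtain T where T: "finite T"
      "\<And>w. (\<lambda>z. act (F (cboost z)) (cboost (- z)) f w) holomorphic_on ball 0 r"
      "\<And>z w. w \<notin> T \<Longrightarrow> act (F (cboost z)) (cboost (- z)) f w = 0"
      using holomorphic_act [OF KC [OF f], of "\<lambda>z. F (cboost z)" "ball 0 r" "\<lambda>z. cboost (- z)"] by blast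
    have \<rho>b: "\<rho>hol (b z) = F (cboost z)" if "z \<in> ball 0 r" for z
      using U(7) b that by simp
    \<comment> \<open>At real rapidity \<open>ginv (b x)\<close> lies over an orthochronous boost,
      so the assumed invariance applies.\<close>
    have real: "act (F (cboost (of_real x))) (cboost (- of_real x)) f \<in> D" if "\<bar>x\<bar> < r" for x
    proof -
      have x: "of_real x \<in> ball (0::complex) r" using that by simp
      have "cboost (- of_real x) \<in> Lup \<eta>" using cboost_real_in_Lup [of "- x"] by simp
      then show ?thesis
        using up [of "ginv (b (of_real x))"] f x
        by (simp add: preserves_def \<pi>_inv_b inv_inv bG grp(3) \<rho>b)
    qed
    have "act (F (cboost z)) (cboost (- z)) f \<in> D"
      using holomorphic_curve_in_affine [of D T "\<lambda>z. act (F (cboost z)) (cboost (- z)) f" r z]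
        affine T real z by blast
    then show "act (\<rho>hol (b z)) (cboost (- z)) f \<in> D"
      using \<rho>b [OF z] by simp
  qed
  \<comment> \<open>The point \<open>\<i> * pi\<close> may lie outside the disc, so it is reached in
    \<open>N\<close> equal steps short enough to stay in the sheet.\<close>
  obtain N :: nat where N: "pi / r < real N"
    using reals_Archimedean2 by blast
  have "N > 0" using N r pi_gt_zero by (cases N) (auto simp: field_simps zero_less_divide_iff)
  define z where "z = \<i> * of_real (pi / N)"
  have z: "z \<in> ball 0 r"
    using N r \<open>N > 0\<close> by (simp add: z_def norm_mult norm_divide field_simps)
  define h where "h n = (mul (b z) ^^ n) e" for n
  have h: "h n \<in> G" "\<pi> (h n) = cboost (of_nat n * z)" "preserves D (\<rho>hol (h n)) (cboost (- (of_nat n * z)))" for n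
  proof (induction n)
    case 0
    { case 1 show ?case by (simp add: h_def grp) }
    { case 2 show ?case by (simp add: h_def \<pi>_e cboost_zero) }
    { case 3 show ?case
        using up [of e] inv_unique [of e e] cboost_real_in_Lup [of 0] by (simp add: h_def grp \<pi>_e cboost_zero) }
  next
    case (Suc n)
    have S: "h (Suc n) = mul (b z) (h n)" by (simp add: h_def)
    { case 1 show ?case using grp(2) [OF bG [OF z]] Suc(1) by (simp add: S) }
    { case 2 show ?case
        using \<pi>_mul [OF bG [OF z] Suc(1)] b(2) [OF z] Suc(2)
        by (simp add: S distrib_right flip: cboost_add) }
    { case 3
      \<comment> \<open>The new factor \<open>b z\<close> multiplies on the left in the V matrix,
        hence its inverse boost must stand on the right in the M matrix.\<close>
      have "- (of_nat (Suc n) * z) = - (of_nat n * z) + - z"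
        by (simp add: algebra_simps)
      then have "cboost (- (of_nat (Suc n) * z)) = cboost (- (of_nat n * z)) ** cboost (- z)"
        by (simp only: cboost_add)
      then show ?case
        using preserves_mult [OF kelem Suc(3) preserves_b [OF z]] \<rho>(2) [OF bG [OF z] Suc(1)]
        by (simp only: S) }
  qed
  have Nz: "of_nat N * z = \<i> * of_real pi"
    using \<open>N > 0\<close> by (simp add: z_def)
  have hN: "\<pi> (h N) = cmat half_turn" "preserves D (\<rho>hol (h N)) (cmat half_turn)"
    using h(2,3) [of N] by (simp_all add: Nz cboost_pi)
  have JJ: "cmat half_turn ** cmat half_turn = mat 1"
    using cboost_add [of "\<i> * of_real pi" "- (\<i> * of_real pi)"] by (simp add: cboost_pi cboost_zero)
  \<comment> \<open>Write \<open>g\<close> as \<open>?k\<close> times the inverse of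
    \<open>h N\<close>. The first factor lies over an orthochronous matrix, and the inverse of
    \<open>h N\<close> acts within \<open>D\<close> by \<open>hN(2)\<close>.\<close>
  have down: "preserves D (\<rho>hol (ginv g)) (\<pi> g)" if g: "g \<in> G" "\<pi> g \<in> Ldown \<eta>" for g
  proof -
    let ?k = "mul g (h N)"
    have "\<pi> ?k = \<pi> g ** cmat half_turn" using g h hN by (simp add: \<pi>_mul)
    then have "preserves D (\<rho>hol (ginv ?k)) (\<pi> g ** cmat half_turn)"
      using up [of ?k] g h grp Ldown_mult_half_turn by simp
    from preserves_mult [OF kelem this hN(2)]
    have "preserves D (\<rho>hol (mul (h N) (ginv ?k))) (\<pi> g ** (cmat half_turn ** cmat half_turn))"
      using g h grp by (simp add: \<rho> matrix_mul_assoc)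
    moreover have "mul (h N) (ginv ?k) = ginv g"
      using g h [of N] by (simp add: inv_mul grp flip: grp(4))
    ultimately show ?thesis by (simp add: JJ)
  qed
  show ?thesis
    using down cl_action_eq_act [of \<pi> _ ginv \<rho>hol]
    by (auto simp: preserves_def invariant_under_def lift_down_def Ldown_def)
qed

end
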